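(* Suppose that $q_0$ is locally polyhedral with constants $\epsilon,L>0$ independent of $V$, i.e. $q_0(\boldsymbol U_0^* )\ge q_0(\boldsymbol U)+L\|\boldsymbol U_0^*-\boldsymbol U\|$ for all $\boldsymbol U\succeq\boldsymbol 0$ with $\|\boldsymbol U-\boldsymbol U_0^*\|<\epsilon$, that a steady state distribution exists for the backlog process generated by QLA, and that the system is in steady state at time $T$ (the end of Step I of FQLA-General). Then under FQLA-General with a sufficiently large $V$, with probability $1-O(1/V^4)$: (a) $\overline U=O(\log^2(V))$; (b) $f_{av}^{FG}=f_{av}^*+O(1/V)$; (c) $P_{drop}=O(1/V^{c_0\log(V)})$, where $c_0=\Theta(1)$, $\overline U$ is the time average backlog, $f_{av}^{FG}$ is the time average cost of FQLA-General, $f^*_{av}$ is the optimal time average cost, and $P_{drop}$ is the time average fraction of packets dropped in Step II(b).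
   Context: Network model. Time is slotted, $t=0,1,2,\dots$; there are $r\ge1$ queues. The network state $S(t)$ takes values in a finite set $\mathcal S=\{s_1,\dots,s_M\}$ and is i.i.d. over slots with $p_{s_i}=\Pr\{S(t)=s_i\}$. When $S(t)=s_i$, the controller observes $s_i$ and chooses an action $x$ in a compact feasible set $\mathcal X^{(s_i)}$; this incurs cost $f(t)=f(s_i,x)$ (the function $f$ is either everywhere nonnegative or everywhere nonpositive), arrivals $A_j(t)=g_j(s_i,x)\ge0$ to queue $j$ and service $\mu_j(t)=b_j(s_i,x)\ge0$ of queue $j$, $j=1,\dots,r$. The magnitudes of $f,g_j,b_j$ are bounded by a constant $\delta_{max}\in(0,\infty)$. Slackness: there are actions $x^{(s_i)k}\in\mathcal X^{(s_i)}$, $k=1,\dots,r+2$, and weights $\vartheta_k^{(s_i)}\ge0$ with $\sum_k\vartheta_k^{(s_i)}=1$ for each $s_i$, and some $\epsilon_s>0$, such that $\sum_{s_i}p_{s_i}\sum_k\vartheta_k^{(s_i)}[g_j(s_i,x^{(s_i)k})-b_j(s_i,x^{(s_i)k})]\le-\epsilon_s$ for all $j$. The backlog vector $\boldsymbol U(t)=(U_1(t),\dots,U_r(t))^T$ (without packet dropping) satisfies $\boldsymbol U(0)=\boldsymbol 0$ and $U_j(t+1)=\max[U_j(t)-\mu_j(t),0]+A_j(t)$. $\|\cdot\|$ is the Euclidean norm, $\succeq$ is entrywise. Averages: time average backlog $\overline U=\limsup_{t\to\infty}\frac1t\sum_{\tau=0}^{t-1}\sum_j\mathbb E\{U_j(\tau)\}$;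 time average cost of a policy $\pi$ is $f^\pi_{av}=\limsup_{t\to\infty}\frac1t\sum_{\tau=0}^{t-1}\mathbb E\{f^\pi(\tau)\}$. A policy is stable if its time average backlog (without packet dropping) is finite; $f^*_{av}$ is the optimal (infimum) time average cost over all stable policies. QLA with parameter $V\ge1$: at each slot $t$, given $\boldsymbol U(t)$ and $S(t)=s_i$, choose $x\in\mathcal X^{(s_i)}$ maximizing $-Vf(s_i,x)+\sum_jU_j(t)[b_j(s_i,x)-g_j(s_i,x)]$. Dual function: $q(\boldsymbol U)=\inf_{x^{(s_i)}\in\mathcal X^{(s_i)}}\sum_{s_i}p_{s_i}\{Vf(s_i,x^{(s_i)})+\sum_jU_j[g_j(s_i,x^{(s_i)})-b_j(s_i,x^{(s_i)})]\}$; its maximizer over $\boldsymbol U\succeq\boldsymbol 0$ is $\boldsymbol U_V^*$, assumed unique for every $V\ge1$. $q_0$ and $\boldsymbol U_0^*$ denote $q$ and its maximizer when $V=1$. FQLA-General. Step I: choose a large time $T$; starting from $\boldsymbol W(0)=\boldsymbol 0$ run QLA with parameter $V$ on the backlog $\boldsymbol W(t)$ to obtain $\boldsymbol W(T)$; set $\mathcal W_j=\max[W_j(T)-\log^2(V),0]$ for each $j$. "In steady state at time $T$" means $\boldsymbol W(T)$ is distributed according to the steady state distribution of the QLA backlog. Step II (time re-indexed from $0$): initialize $U_j(0)=0$, $W_j(0)=\mathcal W_j$ for all $j$. At each slot $t\ge 0$, observe $S(t)=s_i$ and choose $x\in\mathcal X^{(s_i)}$ maximizing the QLA objective with $\boldsymbol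 W(t)$ in place of $\boldsymbol U(t)$; let $A_j(t),\mu_j(t)$ be the resulting arrivals and services and $f(t)$ the cost. For each queue $j$: (a) if $W_j(t)\ge\mathcal W_j$, set $U_j(t+1)=\max[U_j(t)-\mu_j(t),0]+A_j(t)$; (b) if $W_j(t)<\mathcal W_j$, admit only $\tilde A_j(t)=\max[A_j(t)-\mathcal W_j+W_j(t),0]$ arrivals (the other $A_j(t)-\tilde A_j(t)$ packets are dropped) and set $U_j(t+1)=\max[U_j(t)-\mu_j(t),0]+\tilde A_j(t)$; (c) in all cases set $W_j(t+1)=\max[W_j(t)-\mu_j(t),0]+A_j(t)$. The "with probability" statement is over the sample $\boldsymbol W(T)$ (equivalently over the resulting values $\mathcal W_j$); the averages are those of Step II for the given $\mathcal W_j$. $P_{drop}$ is the long-run ratio of the expected number of packets dropped in (b), $\sum_{\tau<t}\sum_j\mathbb E\{A_j(\tau)-\tilde A_j(\tau)\}$, to the expected number of packets generated, $\sum_{\tau<t}\sum_j\mathbb E\{A_j(\tau)\}$. Asymptotic notation refers to $V\to\infty$ with all other problem data fixed.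
   Formalization: Part (c) is asserted only when the expected number of packets generated in Step II tends to infinity; otherwise QLA may, by tie-breaking, stop generating packets after a finite transient, and the ratio can then be of order 1/log²(V), so (c) fails as stated. *)

theory Defs
  imports "HOL-Probability.Probability"
begin

text \<open>
  States form the finite type \<open>'s\<close>, queues the finite (hence nonempty) type \<open>'r\<close>, and actions
  live in a topological space \<open>'x\<close>.
\<close>

record ('s, 'x, 'r::finite) network =
  state_pmf :: "'s pmf"
  feas :: "'s \<Rightarrow> 'x set"
  cost :: "'s \<Rightarrow> 'x \<Rightarrow> real"
  arr :: "'s \<Rightarrow> 'x \<Rightarrow> real^'r"
  srv :: "'s \<Rightarrow> 'x \<Rightarrow> real^'r"

definition slackness :: "('s::finite, 'x, 'r::finite) network \<Rightarrow> bool" where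
  "slackness N \<longleftrightarrow> (\<exists>(y :: 's \<Rightarrow> nat \<Rightarrow> 'x) (\<theta> :: 's \<Rightarrow> nat \<Rightarrow> real) \<epsilon>s.
     \<epsilon>s > 0 \<and>
     (\<forall>s. \<forall>k\<in>{1..CARD('r) + 2}. y s k \<in> feas N s \<and> \<theta> s k \<ge> 0) \<and>
     (\<forall>s. (\<Sum>k = 1..CARD('r) + 2. \<theta> s k) = 1) \<and>
     (\<forall>j. (\<Sum>s\<in>UNIV. pmf (state_pmf N) s *
            (\<Sum>k = 1..CARD('r) + 2. \<theta> s k * (arr N s (y s k) $ j - srv N s (y s k) $ j))) \<le> - \<epsilon>s))"

definition network_model :: "('s::finite, 'x::topological_space, 'r::finite) network \<Rightarrow> real \<Rightarrow> bool" where
  "network_model N \<delta>max \<longleftrightarrow>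
     \<delta>max > 0 \<and>
     (\<forall>s. compact (feas N s)) \<and>
     ((\<forall>s. \<forall>x\<in>feas N s. cost N s x \<ge> 0) \<or> (\<forall>s. \<forall>x\<in>feas N s. cost N s x \<le> 0)) \<and>
     (\<forall>s. \<forall>x\<in>feas N s. \<bar>cost N s x\<bar> \<le> \<delta>max \<and>
        (\<forall>j. 0 \<le> arr N s x $ j \<and> arr N s x $ j \<le> \<delta>max \<and>
             0 \<le> srv N s x $ j \<and> srv N s x $ j \<le> \<delta>max)) \<and>
     slackness N"

definition queue_step :: "real^'r \<Rightarrow> real^'r \<Rightarrow> real^'r \<Rightarrow> real^'r" where
  "queue_step U \<mu> A = (\<chi> j. max (U $ j - \<mu> $ j) 0 + A $ j)"

text \<open>
  A history lists the (state, action) pairs of the past slots, oldest first.  A policy sees the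
  history and the current state and randomizes over actions, so it is causal but otherwise
  arbitrary.  Every queue process below is a function of the history.
\<close>

type_synonym ('s, 'x) policy = "('s \<times> 'x) list \<Rightarrow> 's \<Rightarrow> 'x pmf"

text \<open>Law of the history of slots \<open>0, \<dots>, t - 1\<close>; the fresh draw from \<open>state_pmf\<close> makes the
  states i.i.d.\<close>

primrec history_pmf ::
    "('s, 'x, 'r::finite) network \<Rightarrow> ('s, 'x) policy \<Rightarrow> nat \<Rightarrow> ('s \<times> 'x) list pmf" where
  "history_pmf N P 0 = return_pmf []"
| "history_pmf N P (Suc t) =
     do { h \<leftarrow> history_pmf N P t; s \<leftarrow> state_pmf N; x \<leftarrow> P h s; return_pmf (h @ [(s, x)]) }"

text \<open>Expectation of a quantity of slot \<open>t\<close> that depends on the history before \<open>t\<close>, the state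
  \<open>S(t)\<close> and the action taken in slot \<open>t\<close>.\<close>

definition slot_expectation ::
    "('s, 'x, 'r::finite) network \<Rightarrow> ('s, 'x) policy \<Rightarrow> nat \<Rightarrow> (('s \<times> 'x) list \<Rightarrow> 's \<Rightarrow> 'x \<Rightarrow> real) \<Rightarrow> real" where
  "slot_expectation N P t F =
     measure_pmf.expectation
       (do { h \<leftarrow> history_pmf N P t; s \<leftarrow> state_pmf N; x \<leftarrow> P h s; return_pmf (h, s, x) })
       (\<lambda>(h, s, x). F h s x)"

definition time_average :: "(nat \<Rightarrow> real) \<Rightarrow> ereal" where
  "time_average e = limsup (\<lambda>t. ereal ((\<Sum>\<tau><t. e \<tau>) / real t))"

definition backlog :: "('s, 'x, 'r::finite) network \<Rightarrow> real^'r \<Rightarrow> ('s \<times> 'x) list \<Rightarrow> real^'r" where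
  "backlog N U0 h = foldl (\<lambda>U (s, x). queue_step U (srv N s x) (arr N s x)) U0 h"

definition average_cost :: "('s, 'x, 'r::finite) network \<Rightarrow> ('s, 'x) policy \<Rightarrow> ereal" where
  "average_cost N P = time_average (\<lambda>t. slot_expectation N P t (\<lambda>h s x. cost N s x))"

definition average_backlog :: "('s, 'x, 'r::finite) network \<Rightarrow> ('s, 'x) policy \<Rightarrow> ereal" where
  "average_backlog N P =
     time_average (\<lambda>t. \<Sum>j\<in>UNIV. slot_expectation N P t (\<lambda>h s x. backlog N 0 h $ j))"

definition stable_policy :: "('s, 'x, 'r::finite) network \<Rightarrow> ('s, 'x) policy \<Rightarrow> bool" where
  "stable_policy N P \<longleftrightarrow>
     (\<forall>h s. (\<forall>(s', x')\<in>set h. x' \<in> feas N s') \<longrightarrow> set_pmf (P h s) \<subseteq> feas N s) \<and>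
     average_backlog N P < \<infinity>"

definition optimal_cost :: "('s, 'x, 'r::finite) network \<Rightarrow> ereal" where
  "optimal_cost N = (INF P \<in> {P. stable_policy N P}. average_cost N P)"

definition dual :: "('s::finite, 'x, 'r::finite) network \<Rightarrow> real \<Rightarrow> real^'r \<Rightarrow> real" where
  "dual N V U = (INF x \<in> {x. \<forall>s. x s \<in> feas N s}.
     \<Sum>s\<in>UNIV. pmf (state_pmf N) s *
       (V * cost N s (x s) + (\<Sum>j\<in>UNIV. U $ j * (arr N s (x s) $ j - srv N s (x s) $ j))))"

definition dual_maximizer :: "('s::finite, 'x, 'r::finite) network \<Rightarrow> real \<Rightarrow> real^'r \<Rightarrow> bool" where
  "dual_maximizer N V U \<longleftrightarrow>
     (\<forall>j. 0 \<le> U $ j) \<and> (\<forall>U'. (\<forall>j. 0 \<le> U' $ j) \<longrightarrow> dual N V U' \<le> dual N V U)"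

definition locally_polyhedral :: "(real^'r \<Rightarrow> real) \<Rightarrow> real^'r::finite \<Rightarrow> real \<Rightarrow> real \<Rightarrow> bool" where
  "locally_polyhedral q Ustar \<epsilon> L \<longleftrightarrow>
     (\<forall>U. (\<forall>j. 0 \<le> U $ j) \<and> norm (U - Ustar) < \<epsilon> \<longrightarrow> q Ustar \<ge> q U + L * norm (Ustar - U))"

definition qla_objective ::
    "('s, 'x, 'r::finite) network \<Rightarrow> real \<Rightarrow> real^'r \<Rightarrow> 's \<Rightarrow> 'x \<Rightarrow> real" where
  "qla_objective N V U s x =
     - V * cost N s x + (\<Sum>j\<in>UNIV. U $ j * (srv N s x $ j - arr N s x $ j))"

text \<open>A QLA rule picks a maximizer of the objective; ties may be broken arbitrarily, also at
  random.\<close>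

definition qla_rule ::
    "('s, 'x, 'r::finite) network \<Rightarrow> real \<Rightarrow> (real^'r \<Rightarrow> 's \<Rightarrow> 'x pmf) \<Rightarrow> bool" where
  "qla_rule N V R \<longleftrightarrow> (\<forall>U s. (\<forall>j. 0 \<le> U $ j) \<longrightarrow>
     (\<forall>x\<in>set_pmf (R U s). x \<in> feas N s \<and>
        (\<forall>y\<in>feas N s. qla_objective N V U s y \<le> qla_objective N V U s x)))"

text \<open>A steady state distribution of the backlog under \<open>R\<close>.  Discrete laws suffice: states and
  action randomizations are discrete, so the backlog started at \<open>0\<close> stays in a countable set.\<close>

definition steady_state ::
    "('s, 'x, 'r::finite) network \<Rightarrow> (real^'r \<Rightarrow> 's \<Rightarrow> 'x pmf) \<Rightarrow> (real^'r) pmf \<Rightarrow> bool" where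
  "steady_state N R D \<longleftrightarrow>
     (\<forall>U\<in>set_pmf D. \<forall>j. 0 \<le> U $ j) \<and>
     do { U \<leftarrow> D; s \<leftarrow> state_pmf N; x \<leftarrow> R U s; return_pmf (queue_step U (srv N s x) (arr N s x)) } = D"

text \<open>Placeholder level computed from the outcome \<open>w\<close> of \<open>W(T)\<close>.\<close>

definition fqla_level :: "real \<Rightarrow> real^'r \<Rightarrow> real^'r" where
  "fqla_level V w = (\<chi> j. max (w $ j - (ln V)\<^sup>2) 0)"

definition admitted ::
    "('s, 'x, 'r::finite) network \<Rightarrow> real^'r \<Rightarrow> real^'r \<Rightarrow> 's \<Rightarrow> 'x \<Rightarrow> real^'r" where
  "admitted N \<W> W s x = (\<chi> j. if W $ j \<ge> \<W> $ j then arr N s x $ j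
                               else max (arr N s x $ j - \<W> $ j + W $ j) 0)"

text \<open>The pair \<open>(U, W)\<close> of Step II after the history \<open>h\<close>.\<close>

definition fqla_state ::
    "('s, 'x, 'r::finite) network \<Rightarrow> real^'r \<Rightarrow> ('s \<times> 'x) list \<Rightarrow> (real^'r) \<times> (real^'r)" where
  "fqla_state N \<W> h = foldl (\<lambda>(U, W) (s, x).
     (queue_step U (srv N s x) (admitted N \<W> W s x), queue_step W (srv N s x) (arr N s x))) (0, \<W>) h"

definition fqla_policy ::
    "('s, 'x, 'r::finite) network \<Rightarrow> (real^'r \<Rightarrow> 's \<Rightarrow> 'x pmf) \<Rightarrow> real^'r \<Rightarrow> ('s, 'x) policy" where
  "fqla_policy N R \<W> = (\<lambda>h s. R (snd (fqla_state N \<W> h)) s)"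

definition fqla_average_backlog ::
    "('s, 'x, 'r::finite) network \<Rightarrow> (real^'r \<Rightarrow> 's \<Rightarrow> 'x pmf) \<Rightarrow> real^'r \<Rightarrow> ereal" where
  "fqla_average_backlog N R \<W> = time_average (\<lambda>t. \<Sum>j\<in>UNIV.
     slot_expectation N (fqla_policy N R \<W>) t (\<lambda>h s x. fst (fqla_state N \<W> h) $ j))"

definition fqla_average_cost ::
    "('s, 'x, 'r::finite) network \<Rightarrow> (real^'r \<Rightarrow> 's \<Rightarrow> 'x pmf) \<Rightarrow> real^'r \<Rightarrow> ereal" where
  "fqla_average_cost N R \<W> = average_cost N (fqla_policy N R \<W>)"

definition expected_generated ::
    "('s, 'x, 'r::finite) network \<Rightarrow> (real^'r \<Rightarrow> 's \<Rightarrow> 'x pmf) \<Rightarrow> real^'r \<Rightarrow> nat \<Rightarrow> real" where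
  "expected_generated N R \<W> t = (\<Sum>\<tau><t. \<Sum>j\<in>UNIV.
     slot_expectation N (fqla_policy N R \<W>) \<tau> (\<lambda>h s x. arr N s x $ j))"

definition expected_dropped ::
    "('s, 'x, 'r::finite) network \<Rightarrow> (real^'r \<Rightarrow> 's \<Rightarrow> 'x pmf) \<Rightarrow> real^'r \<Rightarrow> nat \<Rightarrow> real" where
  "expected_dropped N R \<W> t = (\<Sum>\<tau><t. \<Sum>j\<in>UNIV.
     slot_expectation N (fqla_policy N R \<W>) \<tau>
       (\<lambda>h s x. arr N s x $ j - admitted N \<W> (snd (fqla_state N \<W> h)) s x $ j))"

definition drop_fraction ::
    "('s, 'x, 'r::finite) network \<Rightarrow> (real^'r \<Rightarrow> 's \<Rightarrow> 'x pmf) \<Rightarrow> real^'r \<Rightarrow> ereal" where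
  "drop_fraction N R \<W> =
     limsup (\<lambda>t. ereal (expected_dropped N R \<W> t / expected_generated N R \<W> t))"

text \<open>A long-run fraction of packets presupposes that packets keep being generated, i.e. that
  their expected number grows without bound.  Otherwise the ratio only records the finite
  transient and need not be small: QLA may enter the point \<open>U\<^sub>V\<^sup>*\<close> and, by its choice among tied
  maximizers, stay there without ever generating another packet.\<close>

definition keeps_generating ::
    "('s, 'x, 'r::finite) network \<Rightarrow> (real^'r \<Rightarrow> 's \<Rightarrow> 'x pmf) \<Rightarrow> real^'r \<Rightarrow> bool" where
  "keeps_generating N R \<W> \<longleftrightarrow> filterlim (expected_generated N R \<W>) at_top sequentially"

end

theory Submission
  imports Defs
begin

text \<open>
  Let \<open>Us = V *\<^sub>R U0star\<close>.  The dual function is concave in the multiplier and scales linearly in the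
  pair of cost weight and multiplier.  The polyhedral condition, which is local and for \<open>V = 1\<close>,
  therefore implies the global inequality \<open>dual N V U + L * norm (U - Us) \<le> dual N V Us\<close> with the same
  slope \<open>L\<close> (\<open>polyhedral_scaled\<close>).  Since QLA attains the dual value at its current backlog \<open>W\<close>, the
  expected motion of \<open>W\<close> points towards \<open>Us\<close>: outside a ball around \<open>Us\<close> whose radius does not depend on
  \<open>V\<close>, the distance decreases by at least \<open>L / 2\<close> per slot in the mean (\<open>distance_drift\<close>).  As the steps
  are bounded, \<open>exp (\<eta> * norm (W - Us))\<close> then decreases by a fixed factor in the mean outside the ball
  (\<open>exp_drift_far\<close>), again with constants that do not depend on \<open>V\<close>.

  In steady state this exponential has tails \<open>O(1 / c)\<close> (\<open>steady_state_tail\<close>), so it is below \<open>V ^ 4\<close>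
  with probability \<open>1 - O(1 / V ^ 4)\<close>, and then the sample \<open>w\<close> of the first step has distance
  \<open>O(ln V)\<close> from \<open>Us\<close>.  The levels, which are \<open>(ln V)\<^sup>2\<close> below \<open>w\<close> unless they are zero, are thus below \<open>Us\<close>
  by an amount of the order \<open>(ln V)\<^sup>2\<close>.  The rest of the proof is for such a fixed sample.

  Backlog and drops.  The real queue exceeds \<open>W $ j - \<W> $ j\<close>, cut off at zero, by at most one slot's
  worth of packets (\<open>fqla_backlog_bounds\<close>), so the distance of \<open>W\<close> from \<open>Us\<close> and the depth of the levels
  bound the backlog.  A packet is dropped only when \<open>W\<close> is at distance at least
  \<open>(ln V)\<^sup>2 / 2\<close> from \<open>Us\<close>, which is exponentially rare.  That drops are rare per slot does not settle the
  drop fraction, because the number of generated packets may grow arbitrarily slowly: ties between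
  maximizers may let the chain rest near \<open>Us\<close> for a long time.  The remedy is to charge time far
  from \<open>Us\<close> to generated packets instead of slots.  Queues shrink only by packets that arrived
  before, so the total motion of the chain is at most twice the number of arrivals up to boundary
  terms; and near \<open>Us\<close> the exponential changes only as much as the chain moves.  The potential that adds
  a multiple of the total backlog to the exponential makes this exact (\<open>potential_drift\<close>,
  \<open>excess_occupation\<close>).

  Cost.  The squared norm of \<open>W\<close> as a potential gives that the cost of FQLA is at most
  \<open>dual N 1 U0star + O(1 / V)\<close> (\<open>fqla_cost_upper\<close>).  Weak duality shows that no stable policy has
  an average cost below \<open>dual N 1 U0star\<close> (\<open>dual_le_average_cost\<close>).  Conversely the decisions of FQLA
  form a stable policy themselves (\<open>fqla_policy_stable\<close>), so they cannot do better than the optimum.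
\<close>

section \<open>Expectations under discrete laws\<close>

lemma integrable_pmf_bounded:
  fixes f :: "'a \<Rightarrow> real"
  assumes "\<And>x. x \<in> set_pmf p \<Longrightarrow> \<bar>f x\<bar> \<le> B"
  shows "integrable (measure_pmf p) f"
  using assms by (intro measure_pmf.integrable_const_bound[where B = B]) (auto simp: AE_measure_pmf_iff)

text \<open>
  The iterated integral formula asks for a bound on the whole type; cutting \<open>f\<close> off outside the
  support changes neither side, so a bound on the support is enough.  Bounds on the support are
  all there is here: costs, arrivals and services are controlled on feasible actions only.
\<close>

lemma expectation_bind_pmf:
  fixes f :: "'b \<Rightarrow> real"
  assumes bounded: "\<And>y. y \<in> set_pmf (bind_pmf p k) \<Longrightarrow> \<bar>f y\<bar> \<le> B"
  shows "measure_pmf.expectation (bind_pmf p k) f =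
    measure_pmf.expectation p (\<lambda>x. measure_pmf.expectation (k x) f)"
proof -
  define g where "g y = (if y \<in> set_pmf (bind_pmf p k) then f y else 0)" for y
  have g_bound: "\<bar>g y\<bar> \<le> \<bar>B\<bar>" for y
    using order_trans[OF bounded[of y] abs_ge_self[of B]] by (simp add: g_def)
  have "measure_pmf.expectation (bind_pmf p k) f = measure_pmf.expectation (bind_pmf p k) g"
    by (intro integral_cong_AE) (auto simp: AE_measure_pmf_iff g_def)
  also have "\<dots> = measure_pmf.expectation p (\<lambda>x. measure_pmf.expectation (k x) g)"
    unfolding measure_pmf_bind
    by (rule integral_bind[where K = "count_space UNIV" and B = "\<bar>B\<bar>" and B' = 1])
       (auto simp: g_bound measure_pmf.emeasure_space_1 measure_subprob
          intro!: AE_pmfI measure_pmf.finite_measure_axioms)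
  also have "\<dots> = measure_pmf.expectation p (\<lambda>x. measure_pmf.expectation (k x) f)"
    by (intro integral_cong_AE) (auto simp: AE_measure_pmf_iff g_def intro!: integral_cong_AE)
  finally show ?thesis .
qed

lemma expectation_mono_pmf:
  fixes f g :: "'a \<Rightarrow> real"
  assumes "\<And>x. x \<in> set_pmf p \<Longrightarrow> \<bar>f x\<bar> \<le> B"
    and "\<And>x. x \<in> set_pmf p \<Longrightarrow> \<bar>g x\<bar> \<le> B'"
    and "\<And>x. x \<in> set_pmf p \<Longrightarrow> f x \<le> g x"
  shows "measure_pmf.expectation p f \<le> measure_pmf.expectation p g"
  using assms
  by (intro integral_mono_AE integrable_pmf_bounded[of p f B] integrable_pmf_bounded[of p g B'])
     (auto simp: AE_measure_pmf_iff)

lemma expectation_le_pmf: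
  fixes f :: "'a \<Rightarrow> real"
  assumes "\<And>x. x \<in> set_pmf p \<Longrightarrow> \<bar>f x\<bar> \<le> B"
    and "\<And>x. x \<in> set_pmf p \<Longrightarrow> f x \<le> c"
  shows "measure_pmf.expectation p f \<le> c"
  using expectation_mono_pmf[of p f B "\<lambda>_. c" "\<bar>c\<bar>"] assms by simp

lemma ex_support_le_expectation:
  fixes f :: "'a \<Rightarrow> real"
  assumes "\<And>x. x \<in> set_pmf p \<Longrightarrow> \<bar>f x\<bar> \<le> B"
  shows "\<exists>x\<in>set_pmf p. f x \<le> measure_pmf.expectation p f"
proof (rule ccontr)
  assume "\<not> ?thesis"
  then have "AE x in measure_pmf p. - f x < - measure_pmf.expectation p f"
    by (auto simp: AE_measure_pmf_iff not_le)
  moreover have "integrable (measure_pmf p) (\<lambda>x. - f x)"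
    using integrable_pmf_bounded[of p f B] assms by simp
  ultimately have "measure_pmf.expectation p (\<lambda>x. - f x) < - measure_pmf.expectation p f"
    by (rule measure_pmf.expectation_less[rotated])
  then show False by simp
qed

section \<open>One slot of the queueing recursion\<close>

lemma queue_step_nth [simp]: "queue_step U \<mu> A $ j = max (U $ j - \<mu> $ j) 0 + A $ j"
  by (simp add: queue_step_def)

lemma queue_step_nonneg: "0 \<le> A $ j \<Longrightarrow> 0 \<le> queue_step U \<mu> A $ j"
  by simp

text \<open>
  If the queue does not empty this is the binomial formula.  If \<open>w < m\<close>, the service that goes to
  waste is \<open>m - w\<close>, and it is multiplied by \<open>w \<le> d\<close> on the one hand and by \<open>- u \<le> 0\<close> on
  the other.  The sign of the second term is the reason for \<open>0 \<le> u\<close>.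
\<close>

lemma scalar_step_quadratic:
  fixes w u m a d :: real
  assumes "0 \<le> w" "0 \<le> u" "0 \<le> m" "m \<le> d" "0 \<le> a" "a \<le> d"
  shows "(max (w - m) 0 + a - u)\<^sup>2 \<le> (w - u)\<^sup>2 + 2 * ((w - u) * (a - m)) + 3 * d\<^sup>2"
proof (cases "m \<le> w")
  case True
  have "(a - m)\<^sup>2 \<le> d\<^sup>2"
    using assms by (intro power2_le_iff_abs_le[THEN iffD2]) auto
  moreover have "(w - m + a - u)\<^sup>2 = (w - u)\<^sup>2 + 2 * ((w - u) * (a - m)) + (a - m)\<^sup>2"
    by algebra
  ultimately show ?thesis
    using True zero_le_power2[of d] by (simp only: max_absorb1 diff_ge_0_iff_ge)
next
  case False
  have "(max (w - m) 0 + a - u)\<^sup>2 - (w - u)\<^sup>2 - 2 * ((w - u) * (a - m)) = (a - w)\<^sup>2 + 2 * w * (m - w) - 2 * u * (m - w)"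
    using False by (simp add: max_def) algebra
  also have "(a - w)\<^sup>2 \<le> d\<^sup>2"
    using assms False by (intro power2_le_iff_abs_le[THEN iffD2]) auto
  also have "2 * w * (m - w) \<le> 2 * (d * d)"
    using assms False by (simp add: mult.assoc mult_mono)
  finally show ?thesis
    using assms False mult_nonneg_nonneg[of u "m - w"]
    by (simp add: power2_eq_square algebra_simps)
qed

lemma norm_sq_vec: "(norm (x :: real^'n::finite))\<^sup>2 = (\<Sum>j\<in>UNIV. (x $ j)\<^sup>2)"
  unfolding power2_norm_eq_inner inner_vec_def by (simp add: power2_eq_square)

lemma queue_step_quadratic:
  fixes W :: "real^'r::finite" and d :: real
  assumes "\<And>j. 0 \<le> W $ j" "\<And>j. 0 \<le> u $ j"
    and "\<And>j. 0 \<le> \<mu> $ j \<and> \<mu> $ j \<le> d" "\<And>j. 0 \<le> A $ j \<and> A $ j \<le> d"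
  shows "(norm (queue_step W \<mu> A - u))\<^sup>2
    \<le> (norm (W - u))\<^sup>2 + 2 * (\<Sum>j\<in>UNIV. (W $ j - u $ j) * (A $ j - \<mu> $ j)) + 3 * CARD('r) * d\<^sup>2"
proof -
  have "(norm (queue_step W \<mu> A - u))\<^sup>2
      \<le> (\<Sum>j\<in>UNIV. (W $ j - u $ j)\<^sup>2 + 2 * ((W $ j - u $ j) * (A $ j - \<mu> $ j)) + 3 * d\<^sup>2)"
    unfolding norm_sq_vec
    using scalar_step_quadratic[where d=d] assms by (intro sum_mono) simp
  then show ?thesis
    by (simp add: norm_sq_vec sum.distrib flip: sum_distrib_left)
qed

text \<open>
  The actual departures are \<open>A - (W' - W)\<close>.  So the motion of a queue, arrivals plus departures, is
  twice the arrivals up to the telescoping difference \<open>W' - W\<close>: over a long time the queue can only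
  move as much as packets arrive.
\<close>

lemma queue_step_increment:
  fixes W :: "real^'r::finite"
  assumes "0 \<le> W $ j" "0 \<le> \<mu> $ j" "0 \<le> A $ j"
  shows "\<bar>queue_step W \<mu> A $ j - W $ j\<bar> \<le> 2 * A $ j - (queue_step W \<mu> A $ j - W $ j)"
  using assms by (auto simp: max_def abs_if)

lemma norm_queue_step_increment:
  fixes W :: "real^'r::finite" and d :: real
  assumes "\<And>j. 0 \<le> W $ j"
    and "\<And>j. 0 \<le> \<mu> $ j \<and> \<mu> $ j \<le> d" "\<And>j. 0 \<le> A $ j \<and> A $ j \<le> d"
  shows "norm (queue_step W \<mu> A - W) \<le> (\<Sum>j\<in>UNIV. 2 * A $ j - (queue_step W \<mu> A $ j - W $ j))"
    and "norm (queue_step W \<mu> A - W) \<le> CARD('r) * d"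
proof -
  have l1: "norm (queue_step W \<mu> A - W) \<le> (\<Sum>j\<in>UNIV. \<bar>queue_step W \<mu> A $ j - W $ j\<bar>)"
    using norm_le_l1_cart[of "queue_step W \<mu> A - W"] by simp
  also have "\<dots> \<le> (\<Sum>j\<in>UNIV. 2 * A $ j - (queue_step W \<mu> A $ j - W $ j))"
    using assms by (intro sum_mono queue_step_increment) auto
  finally show "norm (queue_step W \<mu> A - W) \<le> (\<Sum>j\<in>UNIV. 2 * A $ j - (queue_step W \<mu> A $ j - W $ j))" .
  have "\<bar>queue_step W \<mu> A $ j - W $ j\<bar> \<le> d" for j
    using assms(1)[of j] assms(2)[of j] assms(3)[of j] by (auto simp: max_def abs_if)
  then have "(\<Sum>j\<in>UNIV. \<bar>queue_step W \<mu> A $ j - W $ j\<bar>) \<le> (\<Sum>j\<in>(UNIV::'r set). d)"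
    by (intro sum_mono)
  with l1 show "norm (queue_step W \<mu> A - W) \<le> CARD('r) * d"
    by simp
qed

section \<open>The dual function\<close>

text \<open>
  The summand of the dual function that belongs to one state.  QLA minimizes it in the action for
  the current backlog, and the dual function is the mean over the states of its minimum.
\<close>

definition lagrangian ::
    "('s, 'x, 'r::finite) network \<Rightarrow> real \<Rightarrow> real^'r \<Rightarrow> 's \<Rightarrow> 'x \<Rightarrow> real" where
  "lagrangian N V U s x = V * cost N s x + (\<Sum>j\<in>UNIV. U $ j * (arr N s x $ j - srv N s x $ j))"

lemma qla_objective_lagrangian: "qla_objective N V U s x = - lagrangian N V U s x"
proof -
  have "(\<Sum>j\<in>UNIV. U $ j * (srv N s x $ j - arr N s x $ j)) =
      - (\<Sum>j\<in>UNIV. U $ j * (arr N s x $ j - srv N s x $ j))"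
    by (simp add: right_diff_distrib flip: sum_negf)
  then show ?thesis
    by (simp add: qla_objective_def lagrangian_def)
qed

text \<open>
  Joint law of the state and the action in one slot, once the history has fixed the randomized
  decision \<open>k\<close>.
\<close>

definition action_pmf ::
    "('s, 'x, 'r::finite) network \<Rightarrow> ('s \<Rightarrow> 'x pmf) \<Rightarrow> ('s \<times> 'x) pmf" where
  "action_pmf N k = do { s \<leftarrow> state_pmf N; x \<leftarrow> k s; return_pmf (s, x) }"

text \<open>
  What the drift arguments use of the network model.  Feasible actions exist by slackness.
\<close>

locale bounded_network =
  fixes N :: "('s::finite, 'x::topological_space, 'r::finite) network" and \<delta> :: real
  assumes \<delta>_pos: "0 < \<delta>"
    and feas_nonempty: "\<And>s. feas N s \<noteq> {}"
    and cost_bounded: "\<And>s x. x \<in> feas N s \<Longrightarrow> \<bar>cost N s x\<bar> \<le> \<delta>"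
    and arr_bounded: "\<And>s x j. x \<in> feas N s \<Longrightarrow> 0 \<le> arr N s x $ j \<and> arr N s x $ j \<le> \<delta>"
    and srv_bounded: "\<And>s x j. x \<in> feas N s \<Longrightarrow> 0 \<le> srv N s x $ j \<and> srv N s x $ j \<le> \<delta>"

lemma network_model_bounded:
  fixes N :: "('s::finite, 'x::topological_space, 'r::finite) network"
  assumes "network_model N \<delta>"
  shows "bounded_network N \<delta>"
proof
  fix s
  from assms have "slackness N"
    by (simp add: network_model_def)
  then obtain y :: "'s \<Rightarrow> nat \<Rightarrow> 'x" where "\<forall>s. \<forall>k\<in>{1..CARD('r) + 2}. y s k \<in> feas N s"
    unfolding slackness_def by blast
  then have "y s 1 \<in> feas N s"
    by auto
  then show "feas N s \<noteq> {}"
    by auto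
qed (use assms in \<open>auto simp: network_model_def\<close>)

context bounded_network
begin

definition lag_bound :: "real \<Rightarrow> real^'r \<Rightarrow> real" where
  "lag_bound V U = \<bar>V\<bar> * \<delta> + (\<Sum>j\<in>UNIV. \<bar>U $ j\<bar> * \<delta>)"

lemma abs_lagrangian_le:
  assumes "x \<in> feas N s"
  shows "\<bar>lagrangian N V U s x\<bar> \<le> lag_bound V U"
proof -
  have "\<bar>V * cost N s x\<bar> \<le> \<bar>V\<bar> * \<delta>"
    using cost_bounded[OF assms] by (simp add: abs_mult mult_left_mono)
  moreover have "\<bar>\<Sum>j\<in>UNIV. U $ j * (arr N s x $ j - srv N s x $ j)\<bar> \<le> (\<Sum>j\<in>UNIV. \<bar>U $ j\<bar> * \<delta>)"
  proof (rule order_trans[OF sum_abs sum_mono])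
    fix j
    have "\<bar>arr N s x $ j - srv N s x $ j\<bar> \<le> \<delta>"
      using arr_bounded[OF assms, of j] srv_bounded[OF assms, of j] by auto
    then show "\<bar>U $ j * (arr N s x $ j - srv N s x $ j)\<bar> \<le> \<bar>U $ j\<bar> * \<delta>"
      by (simp add: abs_mult mult_left_mono)
  qed
  ultimately show ?thesis
    unfolding lagrangian_def lag_bound_def by linarith
qed

lemma expectation_action_pmf:
  assumes feas: "\<And>s. set_pmf (k s) \<subseteq> feas N s"
    and bounded: "\<And>s x. x \<in> feas N s \<Longrightarrow> \<bar>F (s, x)\<bar> \<le> B"
  shows "measure_pmf.expectation (action_pmf N k) F =
    (\<Sum>s\<in>UNIV. pmf (state_pmf N) s * measure_pmf.expectation (k s) (\<lambda>x. F (s, x)))"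
proof -
  have "measure_pmf.expectation (action_pmf N k) F =
      measure_pmf.expectation (state_pmf N)
        (\<lambda>s. measure_pmf.expectation (bind_pmf (k s) (\<lambda>x. return_pmf (s, x))) F)"
    unfolding action_pmf_def using feas bounded by (intro expectation_bind_pmf[where B = B]) fastforce
  also have "\<dots> = measure_pmf.expectation (state_pmf N) (\<lambda>s. measure_pmf.expectation (k s) (\<lambda>x. F (s, x)))"
    by (simp flip: map_pmf_def)
  finally show ?thesis
    by (simp add: integral_measure_pmf_real[where A = UNIV] mult.commute)
qed

lemma dual_lagrangian:
  "dual N V U = (INF x \<in> {x. \<forall>s. x s \<in> feas N s}. \<Sum>s\<in>UNIV. pmf (state_pmf N) s * lagrangian N V U s (x s))"
  by (simp add: dual_def lagrangian_def)

lemma dual_bdd_below: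
  "bdd_below ((\<lambda>x. \<Sum>s\<in>UNIV. pmf (state_pmf N) s * lagrangian N V U s (x s)) ` {x. \<forall>s. x s \<in> feas N s})"
proof (rule bdd_belowI2)
  fix x assume "x \<in> {x. \<forall>s. x s \<in> feas N s}"
  then have "- lag_bound V U \<le> lagrangian N V U s (x s)" for s
    using abs_lagrangian_le[of "x s" s V U] by auto
  then show "(\<Sum>s\<in>UNIV. pmf (state_pmf N) s * - lag_bound V U)
      \<le> (\<Sum>s\<in>UNIV. pmf (state_pmf N) s * lagrangian N V U s (x s))"
    by (intro sum_mono mult_left_mono) auto
qed

lemma dual_le:
  assumes "\<And>s. x s \<in> feas N s"
  shows "dual N V U \<le> (\<Sum>s\<in>UNIV. pmf (state_pmf N) s * lagrangian N V U s (x s))"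
  unfolding dual_lagrangian using assms by (intro cINF_lower[OF dual_bdd_below]) auto

lemma selections_nonempty: "{x. \<forall>s. x s \<in> feas N s} \<noteq> {}"
proof -
  have "(\<lambda>s. SOME y. y \<in> feas N s) \<in> {x. \<forall>s. x s \<in> feas N s}"
    using feas_nonempty by (auto intro: some_in_eq[THEN iffD2])
  then show ?thesis by (metis empty_iff)
qed

lemma dual_ge:
  assumes "\<And>x. (\<And>s. x s \<in> feas N s) \<Longrightarrow>
    c \<le> (\<Sum>s\<in>UNIV. pmf (state_pmf N) s * lagrangian N V U s (x s))"
  shows "c \<le> dual N V U"
  unfolding dual_lagrangian using assms by (intro cINF_greatest[OF selections_nonempty]) auto

text \<open>
  In every state some action in the support does no worse than the mean, so a randomized decision
  is never below the best deterministic one.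
\<close>

lemma dual_le_expectation:
  assumes feas: "\<And>s. set_pmf (k s) \<subseteq> feas N s"
  shows "dual N V U \<le> measure_pmf.expectation (action_pmf N k) (\<lambda>(s, x). lagrangian N V U s x)"
proof -
  have "\<exists>x\<in>set_pmf (k s). lagrangian N V U s x \<le> measure_pmf.expectation (k s) (lagrangian N V U s)" for s
    using feas abs_lagrangian_le[of _ s V U] by (intro ex_support_le_expectation) blast
  then obtain x where x: "\<And>s. x s \<in> set_pmf (k s)"
    "\<And>s. lagrangian N V U s (x s) \<le> measure_pmf.expectation (k s) (lagrangian N V U s)"
    by metis
  have "dual N V U \<le> (\<Sum>s\<in>UNIV. pmf (state_pmf N) s * lagrangian N V U s (x s))"
    using x(1) feas by (intro dual_le) blast
  also have "\<dots> \<le> (\<Sum>s\<in>UNIV. pmf (state_pmf N) s * measure_pmf.expectation (k s) (lagrangian N V U s))"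
    using x(2) by (intro sum_mono mult_left_mono) auto
  also have "\<dots> = measure_pmf.expectation (action_pmf N k) (\<lambda>(s, x). lagrangian N V U s x)"
    using feas abs_lagrangian_le[of _ _ V U] by (subst expectation_action_pmf[where B = "lag_bound V U"]) auto
  finally show ?thesis .
qed

lemma qla_expectation_le_dual:
  assumes qla: "qla_rule N V R" and W: "\<And>j. 0 \<le> W $ j"
  shows "measure_pmf.expectation (action_pmf N (R W)) (\<lambda>(s, x). lagrangian N V W s x) \<le> dual N V W"
proof (rule dual_ge)
  fix y assume y: "\<And>s. y s \<in> feas N s"
  have R: "x \<in> feas N s" "lagrangian N V W s x \<le> lagrangian N V W s (y s)"
    if "x \<in> set_pmf (R W s)" for s x
    using qla W y[of s] that by (auto simp: qla_rule_def qla_objective_lagrangian)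
  have "measure_pmf.expectation (action_pmf N (R W)) (\<lambda>(s, x). lagrangian N V W s x) =
      (\<Sum>s\<in>UNIV. pmf (state_pmf N) s * measure_pmf.expectation (R W s) (lagrangian N V W s))"
    using R(1) abs_lagrangian_le[of _ _ V W]
    by (subst expectation_action_pmf[where B = "lag_bound V W"]) auto
  also have "\<dots> \<le> (\<Sum>s\<in>UNIV. pmf (state_pmf N) s * lagrangian N V W s (y s))"
    using R abs_lagrangian_le[of _ _ V W]
    by (intro sum_mono mult_left_mono expectation_le_pmf[where B = "lag_bound V W"]) auto
  finally show "measure_pmf.expectation (action_pmf N (R W)) (\<lambda>(s, x). lagrangian N V W s x)
      \<le> (\<Sum>s\<in>UNIV. pmf (state_pmf N) s * lagrangian N V W s (y s))" .
qed

text \<open>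
  An infimum of functions that are affine in the multiplier.
\<close>

lemma dual_concave:
  assumes "0 \<le> t" "t \<le> 1"
  shows "(1 - t) * dual N V U + t * dual N V U' \<le> dual N V ((1 - t) *\<^sub>R U + t *\<^sub>R U')"
proof (rule dual_ge)
  fix x assume x: "\<And>s. x s \<in> feas N s"
  have affine: "lagrangian N V ((1 - t) *\<^sub>R U + t *\<^sub>R U') s y =
      (1 - t) * lagrangian N V U s y + t * lagrangian N V U' s y" for s y
    by (simp add: lagrangian_def sum_distrib_left algebra_simps flip: sum.distrib sum_subtractf)
  have "(1 - t) * dual N V U + t * dual N V U' \<le>
      (1 - t) * (\<Sum>s\<in>UNIV. pmf (state_pmf N) s * lagrangian N V U s (x s)) +
      t * (\<Sum>s\<in>UNIV. pmf (state_pmf N) s * lagrangian N V U' s (x s))"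
    using assms x by (intro add_mono mult_left_mono dual_le) auto
  also have "\<dots> = (\<Sum>s\<in>UNIV. pmf (state_pmf N) s * lagrangian N V ((1 - t) *\<^sub>R U + t *\<^sub>R U') s (x s))"
    unfolding affine sum_distrib_left sum.distrib[symmetric] by (intro sum.cong) (simp_all add: algebra_simps)
  finally show "(1 - t) * dual N V U + t * dual N V U' \<le>
      (\<Sum>s\<in>UNIV. pmf (state_pmf N) s * lagrangian N V ((1 - t) *\<^sub>R U + t *\<^sub>R U') s (x s))" .
qed

text \<open>
  The Lagrangian is jointly linear in the cost weight and the multiplier.  Applied to \<open>V\<close> and to
  \<open>1 / V\<close> this gives equality, so the maximizer for the weight \<open>V\<close> is \<open>V\<close> times the one for weight 1.
\<close>

lemma dual_scale_ge:
  assumes "0 < V"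
  shows "V * dual N V' U \<le> dual N (V * V') (V *\<^sub>R U)"
proof (rule dual_ge)
  fix x assume x: "\<And>s. x s \<in> feas N s"
  have "V * dual N V' U \<le> V * (\<Sum>s\<in>UNIV. pmf (state_pmf N) s * lagrangian N V' U s (x s))"
    using assms x by (intro mult_left_mono dual_le) auto
  also have "\<dots> = (\<Sum>s\<in>UNIV. pmf (state_pmf N) s * lagrangian N (V * V') (V *\<^sub>R U) s (x s))"
    by (simp add: lagrangian_def sum_distrib_left algebra_simps)
  finally show "V * dual N V' U \<le> (\<Sum>s\<in>UNIV. pmf (state_pmf N) s * lagrangian N (V * V') (V *\<^sub>R U) s (x s))" .
qed

lemma dual_scale:
  assumes "0 < V"
  shows "dual N V (V *\<^sub>R U) = V * dual N 1 U"
proof (rule antisym)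
  have "(1 / V) * dual N V (V *\<^sub>R U) \<le> dual N ((1 / V) * V) ((1 / V) *\<^sub>R V *\<^sub>R U)"
    using assms by (intro dual_scale_ge) auto
  then show "dual N V (V *\<^sub>R U) \<le> V * dual N 1 U"
    using assms by (simp add: field_simps)
qed (use dual_scale_ge[OF assms, of 1 U] in simp)

text \<open>
  Along the segment from \<open>u\<close> to \<open>U\<close> the concave dual function lies above its chord.  A linear
  decrease near \<open>u\<close> therefore persists, with the same slope, all the way to \<open>U\<close>.
\<close>

lemma polyhedral_global:
  assumes poly: "locally_polyhedral (dual N 1) u \<epsilon> L" and pos: "0 < \<epsilon>" "0 < L"
    and u: "\<And>j. 0 \<le> u $ j" and U: "\<And>j. 0 \<le> U $ j"
  shows "dual N 1 U + L * norm (U - u) \<le> dual N 1 u"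
proof (cases "U = u")
  case False
  define d where "d = norm (U - u)"
  \<comment> \<open>Half the radius, since the local inequality holds only strictly inside it.\<close>
  define t where "t = min 1 (\<epsilon> / (2 * d))"
  have d: "0 < d" using False by (simp add: d_def)
  then have t: "0 < t" "t \<le> 1" using pos by (auto simp: t_def)
  have "t * d \<le> \<epsilon> / (2 * d) * d"
    using d by (intro mult_right_mono) (auto simp: t_def)
  then have td: "t * d < \<epsilon>" using d pos by simp
  define P where "P = (1 - t) *\<^sub>R u + t *\<^sub>R U"
  have P: "P - u = t *\<^sub>R (U - u)" by (simp add: P_def algebra_simps)
  then have norm_P: "norm (P - u) = t * d" using t by (simp add: d_def)
  have "\<forall>j. 0 \<le> P $ j" using u U t by (simp add: P_def)
  then have "dual N 1 P + L * (t * d) \<le> dual N 1 u"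
    using poly[unfolded locally_polyhedral_def, rule_format, of P] td norm_P
    by (simp add: norm_minus_commute)
  moreover have "(1 - t) * dual N 1 u + t * dual N 1 U \<le> dual N 1 P"
    unfolding P_def using t by (intro dual_concave) auto
  ultimately have "t * (dual N 1 U + L * d) \<le> t * dual N 1 u"
    by (simp add: algebra_simps)
  then show ?thesis using t by (simp add: d_def)
qed simp

text \<open>
  Scaling by \<open>V\<close> multiplies values and distances alike, so the slope \<open>L\<close> does not depend on \<open>V\<close>.
  This is where all constants below get their independence of \<open>V\<close> from.
\<close>

lemma polyhedral_scaled:
  assumes poly: "locally_polyhedral (dual N 1) u \<epsilon> L" and pos: "0 < \<epsilon>" "0 < L"
    and u: "\<And>j. 0 \<le> u $ j" and U: "\<And>j. 0 \<le> U $ j" and V: "0 < V"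
  shows "dual N V U + L * norm (U - V *\<^sub>R u) \<le> dual N V (V *\<^sub>R u)"
proof -
  have U_eq: "V *\<^sub>R ((1 / V) *\<^sub>R U) = U" using V by simp
  have "dual N 1 ((1 / V) *\<^sub>R U) + L * norm ((1 / V) *\<^sub>R U - u) \<le> dual N 1 u"
    using U V by (intro polyhedral_global[OF poly pos u]) auto
  from mult_left_mono[OF this, of V] have "V * dual N 1 ((1 / V) *\<^sub>R U) + L * (V * norm ((1 / V) *\<^sub>R U - u)) \<le> V * dual N 1 u"
    using V by (simp add: algebra_simps)
  moreover have "V * norm ((1 / V) *\<^sub>R U - u) = norm (V *\<^sub>R ((1 / V) *\<^sub>R U - u))"
    using V by simp
  ultimately show ?thesis
    using V U_eq by (simp add: dual_scale[symmetric] scaleR_diff_right)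
qed

end

section \<open>Time averages\<close>

lemma time_average_le:
  assumes "\<And>t. (\<Sum>\<tau><t. e \<tau>) \<le> a + c * real t"
  shows "time_average e \<le> ereal c"
proof -
  have "(\<lambda>t. ereal (a / real t + c)) \<longlonglongrightarrow> ereal (0 + c)"
    by (intro tendsto_intros lim_const_over_n)
  then have lim: "limsup (\<lambda>t. ereal (a / real t + c)) = ereal c"
    by (simp add: lim_imp_Limsup)
  have "\<forall>\<^sub>F t in sequentially. ereal ((\<Sum>\<tau><t. e \<tau>) / real t) \<le> ereal (a / real t + c)"
    using eventually_gt_at_top[of 0]
  proof eventually_elim
    case (elim t)
    then show ?case using assms[of t] by (simp add: field_simps)
  qed
  then show ?thesis
    unfolding time_average_def lim[symmetric] by (rule Limsup_mono)
qed

lemma time_average_ge_frequently: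
  assumes "\<exists>\<^sub>F t in sequentially. c \<le> (\<Sum>\<tau><t. e \<tau>) / real t"
  shows "ereal c \<le> time_average e"
proof (rule ccontr)
  assume "\<not> ereal c \<le> time_average e"
  then have "\<forall>\<^sub>F t in sequentially. ereal ((\<Sum>\<tau><t. e \<tau>) / real t) < ereal c"
    unfolding time_average_def by (intro Limsup_lessD) auto
  then show False
    using assms by (auto simp: frequently_def not_le)
qed

text \<open>
  A sequence that eventually exceeds \<open>c * t\<close> has quadratically growing partial sums, so its time
  average is infinite.
\<close>

lemma frequently_sublinear:
  assumes avg: "time_average u < \<infinity>" and u: "\<And>t. 0 \<le> u t" and c: "0 < c"
  shows "\<exists>\<^sub>F t in sequentially. u t \<le> c * real t"
proof (rule ccontr)
  assume "\<not> ?thesis"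
  then have "\<forall>\<^sub>F t in sequentially. c * real t < u t"
    by (simp add: frequently_def not_le)
  then obtain t0 where t0: "\<And>t. t0 \<le> t \<Longrightarrow> c * real t < u t"
    by (auto simp: eventually_sequentially)
  obtain M where "time_average u < ereal M"
    using avg less_PInf_Ex_of_nat by fastforce
  then have "\<forall>\<^sub>F t in sequentially. ereal ((\<Sum>\<tau><t. u \<tau>) / real t) < ereal M"
    unfolding time_average_def by (rule Limsup_lessD)
  then obtain t1 where t1: "\<And>t. t1 \<le> t \<Longrightarrow> (\<Sum>\<tau><t. u \<tau>) / real t < M"
    by (auto simp: eventually_sequentially)
  obtain n :: nat where n: "max (real (Suc (t0 + t1))) (2 * M / c) < real n"
    using reals_Archimedean2 by blast
  then have n': "t0 \<le> n" "t1 \<le> n" "0 < n" "2 * M < c * real n"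
    using c by (auto simp: field_simps)
  \<comment> \<open>The block from \<open>n\<close> to \<open>2 * n\<close> alone contributes \<open>c * n\<^sup>2\<close>, which beats \<open>M * (2 * n)\<close>.\<close>
  have "real n * (c * real n) = (\<Sum>\<tau>\<in>{n..<2 * n}. c * real n)"
    by simp
  also have "\<dots> \<le> (\<Sum>\<tau>\<in>{n..<2 * n}. u \<tau>)"
  proof (rule sum_mono)
    fix \<tau> assume "\<tau> \<in> {n..<2 * n}"
    then have "c * real n \<le> c * real \<tau>" "c * real \<tau> < u \<tau>"
      using c n' t0 by auto
    then show "c * real n \<le> u \<tau>" by simp
  qed
  also have "\<dots> \<le> (\<Sum>\<tau><2 * n. u \<tau>)"
    using u by (intro sum_mono2) auto
  also have "\<dots> < M * real (2 * n)"
    using t1[of "2 * n"] n' by (simp add: field_simps)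
  finally have "real n * (c * real n) < 2 * M * real n" by simp
  then have "c * real n < 2 * M" using n' by (simp add: algebra_simps)
  then show False using n' by simp
qed

section \<open>Histories\<close>

definition feasible_history :: "('s, 'x, 'r::finite) network \<Rightarrow> ('s \<times> 'x) list \<Rightarrow> bool" where
  "feasible_history N h \<longleftrightarrow> (\<forall>(s, x)\<in>set h. x \<in> feas N s)"

definition feasible_policy :: "('s, 'x, 'r::finite) network \<Rightarrow> ('s, 'x) policy \<Rightarrow> bool" where
  "feasible_policy N P \<longleftrightarrow> (\<forall>h s. feasible_history N h \<longrightarrow> set_pmf (P h s) \<subseteq> feas N s)"

lemma feasible_history_Nil [simp]: "feasible_history N []"
  by (simp add: feasible_history_def)

lemma feasible_history_snoc [simp]:
  "feasible_history N (h @ [(s, x)]) \<longleftrightarrow> feasible_history N h \<and> x \<in> feas N s"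
  by (auto simp: feasible_history_def)

lemma feasible_history_induct [consumes 1, case_names Nil snoc]:
  assumes "feasible_history N h" and "Q []"
    and "\<And>h s x. feasible_history N h \<Longrightarrow> x \<in> feas N s \<Longrightarrow> Q h \<Longrightarrow> Q (h @ [(s, x)])"
  shows "Q h"
  using assms(1) by (induction h rule: rev_induct) (auto intro: assms(2,3))

lemma history_pmf_feasible:
  assumes "feasible_policy N P" "h \<in> set_pmf (history_pmf N P t)"
  shows "feasible_history N h \<and> length h = t"
  using assms(2) by (induction t arbitrary: h) (use assms(1) in \<open>fastforce simp: feasible_policy_def\<close>)+

definition slot_pmf ::
    "('s, 'x, 'r::finite) network \<Rightarrow> ('s, 'x) policy \<Rightarrow> nat \<Rightarrow> (('s \<times> 'x) list \<times> 's \<times> 'x) pmf" where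
  "slot_pmf N P t = do { h \<leftarrow> history_pmf N P t; s \<leftarrow> state_pmf N; x \<leftarrow> P h s; return_pmf (h, s, x) }"

lemma slot_expectation_slot_pmf:
  "slot_expectation N P t F = measure_pmf.expectation (slot_pmf N P t) (\<lambda>(h, s, x). F h s x)"
  by (simp add: slot_expectation_def slot_pmf_def)

lemma slot_pmf_feasible:
  assumes "feasible_policy N P" "(h, s, x) \<in> set_pmf (slot_pmf N P t)"
  shows "feasible_history N h \<and> length h = t \<and> x \<in> feas N s"
  using assms history_pmf_feasible[OF assms(1)] by (fastforce simp: slot_pmf_def feasible_policy_def)

text \<open>
  Conditioning on the history: given \<open>h\<close>, only the law of the current state and action remains.
\<close>

lemma slot_pmf_action:
  "slot_pmf N P t = bind_pmf (history_pmf N P t) (\<lambda>h. map_pmf (Pair h) (action_pmf N (P h)))"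
  by (simp add: slot_pmf_def action_pmf_def map_bind_pmf map_pmf_def bind_assoc_pmf bind_return_pmf)

lemma slot_expectation_current:
  "slot_expectation N P t (\<lambda>h s x. \<Phi> h) = measure_pmf.expectation (history_pmf N P t) \<Phi>"
proof -
  have "map_pmf fst (slot_pmf N P t) = history_pmf N P t"
    by (simp add: slot_pmf_action map_bind_pmf pmf.map_comp o_def map_pmf_const bind_return_pmf')
  then have "measure_pmf.expectation (history_pmf N P t) \<Phi> =
      measure_pmf.expectation (slot_pmf N P t) (\<lambda>z. \<Phi> (fst z))"
    by (metis integral_map_pmf)
  then show ?thesis
    by (simp add: slot_expectation_slot_pmf case_prod_unfold)
qed

lemma slot_expectation_next:
  "slot_expectation N P t (\<lambda>h s x. \<Phi> (h @ [(s, x)])) = measure_pmf.expectation (history_pmf N P (Suc t)) \<Phi>"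
proof -
  have "history_pmf N P (Suc t) = map_pmf (\<lambda>(h, s, x). h @ [(s, x)]) (slot_pmf N P t)"
    by (simp add: slot_pmf_def map_bind_pmf)
  then show ?thesis
    by (simp add: slot_expectation_slot_pmf case_prod_unfold)
qed

text \<open>
  All quantities of interest grow at most like a function of the time alone along feasible
  histories.  This closure-friendly property gives every integrability condition below; it is not
  uniform in \<open>t\<close>, because backlogs may grow linearly.
\<close>

definition slot_bounded ::
    "('s, 'x, 'r::finite) network \<Rightarrow> (('s \<times> 'x) list \<Rightarrow> 's \<Rightarrow> 'x \<Rightarrow> real) \<Rightarrow> bool" where
  "slot_bounded N F \<longleftrightarrow> (\<forall>t. \<exists>B. \<forall>h s x.
     feasible_history N h \<longrightarrow> length h = t \<longrightarrow> x \<in> feas N s \<longrightarrow> \<bar>F h s x\<bar> \<le> B)"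

lemma slot_boundedI:
  assumes "\<And>h s x. feasible_history N h \<Longrightarrow> x \<in> feas N s \<Longrightarrow> \<bar>F h s x\<bar> \<le> B (length h)"
  shows "slot_bounded N F"
  unfolding slot_bounded_def
proof
  fix t
  show "\<exists>B. \<forall>h s x. feasible_history N h \<longrightarrow> length h = t \<longrightarrow> x \<in> feas N s \<longrightarrow> \<bar>F h s x\<bar> \<le> B"
    using assms by (intro exI[of _ "B t"]) auto
qed

lemma slot_boundedE:
  assumes "slot_bounded N F"
  obtains B where "\<And>h s x. feasible_history N h \<Longrightarrow> length h = t \<Longrightarrow> x \<in> feas N s \<Longrightarrow> \<bar>F h s x\<bar> \<le> B"
  using assms unfolding slot_bounded_def by blast

lemma slot_bounded_const [simp]: "slot_bounded N (\<lambda>h s x. c)"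
  by (rule slot_boundedI[where B = "\<lambda>_. \<bar>c\<bar>"]) simp

lemma slot_bounded_add:
  assumes "slot_bounded N F" "slot_bounded N G"
  shows "slot_bounded N (\<lambda>h s x. F h s x + G h s x)"
  unfolding slot_bounded_def
proof
  fix t
  obtain B where B: "\<And>h s x. feasible_history N h \<Longrightarrow> length h = t \<Longrightarrow> x \<in> feas N s \<Longrightarrow> \<bar>F h s x\<bar> \<le> B"
    using slot_boundedE[where t = t, OF assms(1)] by blast
  obtain B' where B': "\<And>h s x. feasible_history N h \<Longrightarrow> length h = t \<Longrightarrow> x \<in> feas N s \<Longrightarrow> \<bar>G h s x\<bar> \<le> B'"
    using slot_boundedE[where t = t, OF assms(2)] by blast
  from B B' have "\<bar>F h s x + G h s x\<bar> \<le> B + B'"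
    if "feasible_history N h" "length h = t" "x \<in> feas N s" for h s x
    using that by (intro order_trans[OF abs_triangle_ineq add_mono])
  then show "\<exists>B. \<forall>h s x. feasible_history N h \<longrightarrow> length h = t \<longrightarrow> x \<in> feas N s \<longrightarrow> \<bar>F h s x + G h s x\<bar> \<le> B"
    by blast
qed

lemma slot_bounded_mult:
  assumes "slot_bounded N F" "slot_bounded N G"
  shows "slot_bounded N (\<lambda>h s x. F h s x * G h s x)"
  unfolding slot_bounded_def
proof
  fix t
  obtain B where B: "\<And>h s x. feasible_history N h \<Longrightarrow> length h = t \<Longrightarrow> x \<in> feas N s \<Longrightarrow> \<bar>F h s x\<bar> \<le> B"
    using slot_boundedE[where t = t, OF assms(1)] by blast
  obtain B' where B': "\<And>h s x. feasible_history N h \<Longrightarrow> length h = t \<Longrightarrow> x \<in> feas N s \<Longrightarrow> \<bar>G h s x\<bar> \<le> B'"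
    using slot_boundedE[where t = t, OF assms(2)] by blast
  have "\<bar>F h s x * G h s x\<bar> \<le> \<bar>B\<bar> * \<bar>B'\<bar>"
    if "feasible_history N h" "length h = t" "x \<in> feas N s" for h s x
    unfolding abs_mult using B[OF that] B'[OF that] by (intro mult_mono) auto
  then show "\<exists>B. \<forall>h s x. feasible_history N h \<longrightarrow> length h = t \<longrightarrow> x \<in> feas N s \<longrightarrow> \<bar>F h s x * G h s x\<bar> \<le> B"
    by blast
qed

lemma slot_bounded_cmult: "slot_bounded N F \<Longrightarrow> slot_bounded N (\<lambda>h s x. c * F h s x)"
  by (rule slot_bounded_mult[OF slot_bounded_const])

lemma slot_bounded_uminus: "slot_bounded N F \<Longrightarrow> slot_bounded N (\<lambda>h s x. - F h s x)"
  using slot_bounded_cmult[of N F "-1"] by simp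

lemma slot_bounded_diff:
  "slot_bounded N F \<Longrightarrow> slot_bounded N G \<Longrightarrow> slot_bounded N (\<lambda>h s x. F h s x - G h s x)"
  using slot_bounded_add[OF _ slot_bounded_uminus, of N F G] by simp

lemma slot_bounded_sum:
  "(\<And>i. i \<in> I \<Longrightarrow> slot_bounded N (F i)) \<Longrightarrow> slot_bounded N (\<lambda>h s x. \<Sum>i\<in>I. F i h s x)"
  by (induction I rule: infinite_finite_induct) (auto intro: slot_bounded_add)

lemmas slot_bounded_intros =
  slot_bounded_const slot_bounded_add slot_bounded_cmult slot_bounded_uminus slot_bounded_diff slot_bounded_sum

lemma slot_bounded_next:
  assumes "slot_bounded N (\<lambda>h s x. \<Phi> h)" and "\<And>s. feas N s \<noteq> {}"
  shows "slot_bounded N (\<lambda>h s x. \<Phi> (h @ [(s, x)]))"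
  unfolding slot_bounded_def
proof
  fix t
  obtain B where "\<And>h s x. feasible_history N h \<Longrightarrow> length h = Suc t \<Longrightarrow> x \<in> feas N s \<Longrightarrow> \<bar>\<Phi> h\<bar> \<le> B"
    using slot_boundedE[where t = "Suc t", OF assms(1)] by blast
  then show "\<exists>B. \<forall>h s x. feasible_history N h \<longrightarrow> length h = t \<longrightarrow> x \<in> feas N s \<longrightarrow> \<bar>\<Phi> (h @ [(s, x)])\<bar> \<le> B"
    using assms(2) by (intro exI[of _ B]) auto
qed

lemma slot_bounded_support:
  assumes "feasible_policy N P" "slot_bounded N F"
  obtains B where "\<And>z. z \<in> set_pmf (slot_pmf N P t) \<Longrightarrow> \<bar>case z of (h, s, x) \<Rightarrow> F h s x\<bar> \<le> B"
proof -
  obtain B where "\<And>h s x. feasible_history N h \<Longrightarrow> length h = t \<Longrightarrow> x \<in> feas N s \<Longrightarrow> \<bar>F h s x\<bar> \<le> B"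
    using slot_boundedE[where t = t, OF assms(2)] by blast
  then show thesis
    using slot_pmf_feasible[OF assms(1)] by (intro that[of B]) auto
qed

lemma slot_bounded_integrable:
  assumes "feasible_policy N P" "slot_bounded N F"
  shows "integrable (measure_pmf (slot_pmf N P t)) (\<lambda>(h, s, x). F h s x)"
  by (rule slot_bounded_support[where t = t, OF assms]) (rule integrable_pmf_bounded)

lemma slot_expectation_mono:
  assumes P: "feasible_policy N P" and "slot_bounded N F" "slot_bounded N G"
    and "\<And>h s x. feasible_history N h \<Longrightarrow> x \<in> feas N s \<Longrightarrow> F h s x \<le> G h s x"
  shows "slot_expectation N P t F \<le> slot_expectation N P t G"
  unfolding slot_expectation_slot_pmf
  using slot_pmf_feasible[OF P] assms
  by (intro integral_mono_AE slot_bounded_integrable[OF P]) (auto simp: AE_measure_pmf_iff)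

lemma slot_expectation_add:
  assumes P: "feasible_policy N P" and "slot_bounded N F" "slot_bounded N G"
  shows "slot_expectation N P t (\<lambda>h s x. F h s x + G h s x) =
    slot_expectation N P t F + slot_expectation N P t G"
  unfolding slot_expectation_slot_pmf
  using assms Bochner_Integration.integral_add[OF slot_bounded_integrable[OF P, of F t] slot_bounded_integrable[OF P, of G t]]
  by (simp add: case_prod_unfold)

lemma slot_expectation_cmult:
  "slot_expectation N P t (\<lambda>h s x. c * F h s x) = c * slot_expectation N P t F"
  by (simp add: slot_expectation_slot_pmf case_prod_unfold)

lemma slot_expectation_const [simp]: "slot_expectation N P t (\<lambda>h s x. c) = c"
  by (simp add: slot_expectation_slot_pmf case_prod_unfold)

lemma slot_expectation_sum:
  assumes P: "feasible_policy N P" and "\<And>i. i \<in> I \<Longrightarrow> slot_bounded N (F i)"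
  shows "slot_expectation N P t (\<lambda>h s x. \<Sum>i\<in>I. F i h s x) = (\<Sum>i\<in>I. slot_expectation N P t (F i))"
  using assms(2)
  by (induction I rule: infinite_finite_induct) (auto simp: slot_expectation_add[OF P] slot_bounded_sum)

lemma slot_expectation_iterated:
  assumes P: "feasible_policy N P" and F: "slot_bounded N F"
  shows "slot_expectation N P t F = measure_pmf.expectation (history_pmf N P t)
    (\<lambda>h. measure_pmf.expectation (action_pmf N (P h)) (\<lambda>(s, x). F h s x))"
proof -
  obtain B where "\<And>z. z \<in> set_pmf (slot_pmf N P t) \<Longrightarrow> \<bar>case z of (h, s, x) \<Rightarrow> F h s x\<bar> \<le> B"
    using slot_bounded_support[where t = t, OF P F] by blast
  then have "slot_expectation N P t F = measure_pmf.expectation (history_pmf N P t)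
      (\<lambda>h. measure_pmf.expectation (map_pmf (Pair h) (action_pmf N (P h))) (\<lambda>(h, s, x). F h s x))"
    unfolding slot_expectation_slot_pmf slot_pmf_action
    by (intro expectation_bind_pmf[where B = B]) assumption
  then show ?thesis by simp
qed

lemma action_pmf_support:
  "(s, x) \<in> set_pmf (action_pmf N k) \<Longrightarrow> x \<in> set_pmf (k s)"
  by (auto simp: action_pmf_def)

text \<open>
  The drift condition is conditional on the history, and holds for every feasible history; taking
  expectations over the history turns it into an inequality between consecutive slots.
\<close>

lemma (in bounded_network) slot_drift:
  assumes P: "feasible_policy N P"
    and \<Phi>: "slot_bounded N (\<lambda>h s x. \<Phi> h)" and G: "slot_bounded N G"
    and drift: "\<And>h. feasible_history N h \<Longrightarrow>
      measure_pmf.expectation (action_pmf N (P h)) (\<lambda>(s, x). \<Phi> (h @ [(s, x)]) + G h s x) \<le> \<Phi> h + c"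
  shows "measure_pmf.expectation (history_pmf N P (Suc t)) \<Phi> + slot_expectation N P t G
    \<le> measure_pmf.expectation (history_pmf N P t) \<Phi> + c"
proof -
  note \<Phi>' = slot_bounded_next[OF \<Phi> feas_nonempty]
  define F where "F h s x = \<Phi> (h @ [(s, x)]) + G h s x" for h s x
  have F: "slot_bounded N F"
    unfolding F_def by (intro slot_bounded_add \<Phi>' G)
  obtain B where B: "\<And>h s x. feasible_history N h \<Longrightarrow> length h = t \<Longrightarrow> x \<in> feas N s \<Longrightarrow> \<bar>F h s x\<bar> \<le> B"
    using slot_boundedE[where t = t, OF F] by blast
  obtain B' where B': "\<And>h s x. feasible_history N h \<Longrightarrow> length h = t \<Longrightarrow> x \<in> feas N s \<Longrightarrow> \<bar>\<Phi> h + c\<bar> \<le> B'"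
    using slot_boundedE[where t = t, OF slot_bounded_add[OF \<Phi> slot_bounded_const[of N c]]] by blast
  have feas: "x \<in> feas N s" if "feasible_history N h" "(s, x) \<in> set_pmf (action_pmf N (P h))" for h s x
    using that P action_pmf_support[of s x N "P h"] unfolding feasible_policy_def by blast
  have "measure_pmf.expectation (history_pmf N P (Suc t)) \<Phi> + slot_expectation N P t G = slot_expectation N P t F"
    unfolding F_def by (simp only: slot_expectation_add[OF P \<Phi>' G] slot_expectation_next)
  also have "\<dots> = measure_pmf.expectation (history_pmf N P t)
      (\<lambda>h. measure_pmf.expectation (action_pmf N (P h)) (\<lambda>(s, x). F h s x))"
    by (rule slot_expectation_iterated[OF P F])
  also have "\<dots> \<le> measure_pmf.expectation (history_pmf N P t) (\<lambda>h. \<Phi> h + c)"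
  proof (rule expectation_mono_pmf)
    fix h assume "h \<in> set_pmf (history_pmf N P t)"
    then have h: "feasible_history N h" "length h = t"
      using history_pmf_feasible[OF P] by auto
    show "measure_pmf.expectation (action_pmf N (P h)) (\<lambda>(s, x). F h s x) \<le> \<Phi> h + c"
      using drift[OF h(1)] by (simp add: F_def)
    have bd: "\<bar>case z of (s, x) \<Rightarrow> F h s x\<bar> \<le> B" if "z \<in> set_pmf (action_pmf N (P h))" for z
      using that B[OF h] feas[OF h(1)] by (cases z) auto
    show "\<bar>measure_pmf.expectation (action_pmf N (P h)) (\<lambda>(s, x). F h s x)\<bar> \<le> B"
      using expectation_le_pmf[of "action_pmf N (P h)" "\<lambda>(s, x). F h s x" B B]
        expectation_le_pmf[of "action_pmf N (P h)" "\<lambda>z. - (case z of (s, x) \<Rightarrow> F h s x)" B B] bd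
      by (fastforce simp: abs_le_iff)
    show "\<bar>\<Phi> h + c\<bar> \<le> B'"
      using B'[OF h] feas_nonempty by blast
  qed
  also have "\<dots> = slot_expectation N P t (\<lambda>h s x. \<Phi> h + c)"
    by (rule slot_expectation_current[symmetric])
  also have "\<dots> = measure_pmf.expectation (history_pmf N P t) \<Phi> + c"
    by (subst slot_expectation_add[OF P \<Phi> slot_bounded_const]) (simp add: slot_expectation_current)
  finally show ?thesis .
qed

text \<open>
  All long-run estimates come from this inequality: \<open>\<Phi>\<close> is a potential, \<open>G\<close> the quantity whose
  accumulated expectation is to be bounded.  The initial potential \<open>\<Phi> []\<close> is paid only once and
  disappears in time averages.
\<close>

lemma (in bounded_network) telescoped_drift:
  assumes P: "feasible_policy N P"
    and \<Phi>: "slot_bounded N (\<lambda>h s x. \<Phi> h)" and G: "slot_bounded N G"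
    and drift: "\<And>h. feasible_history N h \<Longrightarrow>
      measure_pmf.expectation (action_pmf N (P h)) (\<lambda>(s, x). \<Phi> (h @ [(s, x)]) + G h s x) \<le> \<Phi> h + c"
  shows "measure_pmf.expectation (history_pmf N P t) \<Phi> + (\<Sum>\<tau><t. slot_expectation N P \<tau> G)
    \<le> \<Phi> [] + c * real t"
proof (induction t)
  case (Suc t)
  with slot_drift[OF assms, of t] show ?case by (simp add: algebra_simps)
qed simp

section \<open>Backlogs without dropping\<close>

lemma backlog_Nil [simp]: "backlog N U0 [] = U0"
  by (simp add: backlog_def)

lemma backlog_snoc [simp]:
  "backlog N U0 (h @ [(s, x)]) = queue_step (backlog N U0 h) (srv N s x) (arr N s x)"
  by (simp add: backlog_def)

context bounded_network
begin

lemma arr_nonneg: "x \<in> feas N s \<Longrightarrow> 0 \<le> arr N s x $ j"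
  and arr_le: "x \<in> feas N s \<Longrightarrow> arr N s x $ j \<le> \<delta>"
  and srv_nonneg: "x \<in> feas N s \<Longrightarrow> 0 \<le> srv N s x $ j"
  using arr_bounded srv_bounded by auto

lemma backlog_nonneg:
  assumes "feasible_history N h" "\<And>j. 0 \<le> U0 $ j"
  shows "0 \<le> backlog N U0 h $ j"
  using assms(1) by (induction h rule: feasible_history_induct) (use assms(2) arr_nonneg in auto)

lemma backlog_mono:
  assumes "feasible_history N h" "\<And>j. U0 $ j \<le> U0' $ j"
  shows "backlog N U0 h $ j \<le> backlog N U0' h $ j"
  using assms(1) by (induction h rule: feasible_history_induct) (use assms(2) in auto)

lemma norm_backlog_le:
  assumes "feasible_history N h" "\<And>j. 0 \<le> U0 $ j"
  shows "norm (backlog N U0 h - u) \<le> norm (U0 - u) + length h * (CARD('r) * \<delta>)"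
  using assms(1)
proof (induction h rule: feasible_history_induct)
  case (snoc h s x)
  let ?W = "backlog N U0 h"
  have "norm (backlog N U0 (h @ [(s, x)]) - ?W) \<le> CARD('r) * \<delta>"
    using snoc backlog_nonneg[OF snoc(1) assms(2)] arr_bounded srv_bounded
    by (simp del: queue_step_nth) (intro norm_queue_step_increment(2), auto)
  moreover have "norm (backlog N U0 (h @ [(s, x)]) - u)
      \<le> norm (backlog N U0 (h @ [(s, x)]) - ?W) + norm (?W - u)"
    using norm_triangle_ineq[of "backlog N U0 (h @ [(s, x)]) - ?W" "?W - u"] by simp
  ultimately show ?case
    using snoc by (simp add: algebra_simps)
qed simp

lemma slot_bounded_norm_backlog:
  assumes "\<And>j. 0 \<le> U0 $ j"
  shows "slot_bounded N (\<lambda>h s x. norm (backlog N U0 h - u))"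
  using norm_backlog_le assms
  by (intro slot_boundedI[where B = "\<lambda>t. norm (U0 - u) + t * (CARD('r) * \<delta>)"]) auto

lemma slot_bounded_backlog:
  assumes "\<And>j. 0 \<le> U0 $ j"
  shows "slot_bounded N (\<lambda>h s x. backlog N U0 h $ j)"
proof (rule slot_boundedI)
  fix h s x assume "feasible_history N h"
  then show "\<bar>backlog N U0 h $ j\<bar> \<le> norm (U0 - 0) + length h * (CARD('r) * \<delta>)"
    using norm_backlog_le[of h U0 0] assms component_le_norm_cart[of "backlog N U0 h" j] by simp
qed

lemma slot_bounded_cost: "slot_bounded N (\<lambda>h s x. cost N s x)"
  using cost_bounded by (intro slot_boundedI[where B = "\<lambda>_. \<delta>"]) auto

lemma slot_bounded_arr: "slot_bounded N (\<lambda>h s x. arr N s x $ j)"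
  using arr_bounded by (intro slot_boundedI[where B = "\<lambda>_. \<delta>"]) auto

text \<open>
  The form in which one-slot expectations are estimated: a pointwise bound that is affine in a
  quantity \<open>G\<close> whose expectation is already under control.
\<close>

lemma action_expectation_affine_le:
  fixes B B' :: real
  assumes feas: "\<And>s. set_pmf (k s) \<subseteq> feas N s"
    and F: "\<And>s x. x \<in> feas N s \<Longrightarrow> \<bar>F s x\<bar> \<le> B" and G: "\<And>s x. x \<in> feas N s \<Longrightarrow> \<bar>G s x\<bar> \<le> B'"
    and le: "\<And>s x. x \<in> feas N s \<Longrightarrow> F s x \<le> a + b * G s x"
  shows "measure_pmf.expectation (action_pmf N k) (\<lambda>(s, x). F s x)
    \<le> a + b * measure_pmf.expectation (action_pmf N k) (\<lambda>(s, x). G s x)"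
proof -
  have supp: "x \<in> feas N s" if "(s, x) \<in> set_pmf (action_pmf N k)" for s x
    using feas action_pmf_support[OF that] by blast
  have int: "integrable (action_pmf N k) (\<lambda>(s, x). G s x)"
    using supp G by (intro integrable_pmf_bounded[where B = B']) auto
  have "measure_pmf.expectation (action_pmf N k) (\<lambda>(s, x). F s x)
      \<le> measure_pmf.expectation (action_pmf N k) (\<lambda>z. a + b * (case z of (s, x) \<Rightarrow> G s x))"
    using supp F le int
    by (intro integral_mono_AE integrable_pmf_bounded[of "action_pmf N k" "\<lambda>(s, x). F s x" B]
          Bochner_Integration.integrable_add integrable_mult_right)
       (auto simp: AE_measure_pmf_iff)
  also have "\<dots> = a + b * measure_pmf.expectation (action_pmf N k) (\<lambda>(s, x). G s x)"
    using int by (subst Bochner_Integration.integral_add) auto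
  finally show ?thesis .
qed

section \<open>Weak duality for stable policies\<close>

lemma stable_policy_feasible:
  "stable_policy N P \<Longrightarrow> feasible_policy N P"
  by (simp add: stable_policy_def feasible_policy_def feasible_history_def)

text \<open>
  Drift inequality for the linear potential \<open>- (u \<bullet> U)\<close>.  Since idle service is ignored by the
  queues, \<open>U (t + 1) \<ge> U t + A - \<mu>\<close>, and in each slot the expected cost plus \<open>u \<bullet> (A - \<mu>)\<close> is at
  least the dual value.
\<close>

lemma policy_cost_lower_bound:
  assumes P: "feasible_policy N P" and u: "\<And>j. 0 \<le> u $ j"
  shows "dual N 1 u * t - (\<Sum>j\<in>UNIV. u $ j * slot_expectation N P t (\<lambda>h s x. backlog N 0 h $ j))
    \<le> (\<Sum>\<tau><t. slot_expectation N P \<tau> (\<lambda>h s x. cost N s x))"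
proof -
  define \<Phi> where "\<Phi> h = (\<Sum>j\<in>UNIV. - u $ j * backlog N 0 h $ j)" for h
  have \<Phi>: "slot_bounded N (\<lambda>h s x. \<Phi> h)"
    unfolding \<Phi>_def by (intro slot_bounded_intros slot_bounded_backlog) simp
  have "measure_pmf.expectation (history_pmf N P t) \<Phi> + (\<Sum>\<tau><t. slot_expectation N P \<tau> (\<lambda>h s x. - cost N s x))
      \<le> \<Phi> [] + - dual N 1 u * real t"
  proof (rule telescoped_drift[OF P \<Phi> slot_bounded_uminus[OF slot_bounded_cost]])
    fix h assume h: "feasible_history N h"
    have "slot_bounded N (\<lambda>h s x. \<Phi> (h @ [(s, x)]) + - cost N s x)"
      by (intro slot_bounded_intros slot_bounded_next[OF \<Phi> feas_nonempty] slot_bounded_cost)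
    then obtain B where B: "\<And>h' s x. feasible_history N h' \<Longrightarrow> length h' = length h \<Longrightarrow> x \<in> feas N s \<Longrightarrow>
        \<bar>\<Phi> (h' @ [(s, x)]) + - cost N s x\<bar> \<le> B"
      using slot_boundedE by blast
    have Ph: "\<And>s. set_pmf (P h s) \<subseteq> feas N s"
      using P h by (simp add: feasible_policy_def)
    have "measure_pmf.expectation (action_pmf N (P h)) (\<lambda>(s, x). \<Phi> (h @ [(s, x)]) + - cost N s x)
        \<le> \<Phi> h + -1 * measure_pmf.expectation (action_pmf N (P h)) (\<lambda>(s, x). lagrangian N 1 u s x)"
    proof (rule action_expectation_affine_le[OF Ph B[OF h refl] abs_lagrangian_le])
      fix s x assume x: "x \<in> feas N s"
      have "- u $ j * backlog N 0 (h @ [(s, x)]) $ j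
          \<le> - u $ j * backlog N 0 h $ j - u $ j * (arr N s x $ j - srv N s x $ j)" for j
        using mult_left_mono[OF _ u[of j], of "backlog N 0 h $ j + (arr N s x $ j - srv N s x $ j)" "backlog N 0 (h @ [(s, x)]) $ j"]
        by (simp add: algebra_simps)
      from sum_mono[of UNIV, OF this]
      show "\<Phi> (h @ [(s, x)]) + - cost N s x \<le> \<Phi> h + - 1 * lagrangian N 1 u s x"
        by (simp add: \<Phi>_def lagrangian_def sum_subtractf)
    qed
    also have "\<dots> \<le> \<Phi> h + - dual N 1 u"
      using dual_le_expectation[OF Ph, of 1 u] by simp
    finally show "measure_pmf.expectation (action_pmf N (P h)) (\<lambda>(s, x). \<Phi> (h @ [(s, x)]) + - cost N s x)
        \<le> \<Phi> h + - dual N 1 u" .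
  qed
  moreover have "measure_pmf.expectation (history_pmf N P t) \<Phi> =
      (\<Sum>j\<in>UNIV. - u $ j * slot_expectation N P t (\<lambda>h s x. backlog N 0 h $ j))"
    unfolding slot_expectation_current[symmetric] \<Phi>_def
    by (subst slot_expectation_sum[OF P])
      (simp_all only: slot_expectation_cmult, intro slot_bounded_intros slot_bounded_backlog, simp)
  moreover have "slot_expectation N P \<tau> (\<lambda>h s x. - cost N s x) = - slot_expectation N P \<tau> (\<lambda>h s x. cost N s x)" for \<tau>
    using slot_expectation_cmult[of N P \<tau> "-1" "\<lambda>h s x. cost N s x"] by simp
  moreover have "\<Phi> [] = 0"
    by (simp add: \<Phi>_def)
  ultimately show ?thesis
    by (simp add: sum_negf algebra_simps)
qed

text \<open>
  The error term in the preceding bound is the expected backlog at time \<open>t\<close>.  As its time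
  average is finite, it is small against \<open>t\<close> infinitely often, and this suffices because the average
  cost is a limit superior.
\<close>

lemma dual_le_average_cost:
  assumes P: "stable_policy N P" and u: "\<And>j. 0 \<le> u $ j"
  shows "ereal (dual N 1 u) \<le> average_cost N P"
proof (rule ereal_le_epsilon2)
  fix e :: real assume e: "0 < e"
  note feas = stable_policy_feasible[OF P]
  define Q where "Q t = (\<Sum>j\<in>UNIV. slot_expectation N P t (\<lambda>h s x. backlog N 0 h $ j))" for t
  have Qj: "0 \<le> slot_expectation N P t (\<lambda>h s x. backlog N 0 h $ j)" for t j
    using slot_expectation_mono[OF feas slot_bounded_const[of N 0] slot_bounded_backlog, of 0 j t] backlog_nonneg
    by simp
  define m where "m = 1 + (\<Sum>j\<in>UNIV. u $ j)"
  have m: "0 < m" "u $ j \<le> m" for j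
    using u sum_nonneg[of UNIV "\<lambda>j. u $ j"] member_le_sum[of j UNIV "\<lambda>j. u $ j"] by (auto simp: m_def)
  have "\<exists>\<^sub>F t in sequentially. Q t \<le> (e / m) * real t"
  proof (rule frequently_sublinear)
    show "time_average Q < \<infinity>"
      using P by (simp add: stable_policy_def average_backlog_def Q_def[abs_def])
    show "0 \<le> Q t" for t
      unfolding Q_def by (intro sum_nonneg Qj)
  qed (use e m in auto)
  then have "\<exists>\<^sub>F t in sequentially. dual N 1 u - e
      \<le> (\<Sum>\<tau><t. slot_expectation N P \<tau> (\<lambda>h s x. cost N s x)) / real t"
  proof (rule frequently_rev_mp)
    show "\<forall>\<^sub>F t in sequentially. Q t \<le> (e / m) * real t \<longrightarrow> dual N 1 u - e
      \<le> (\<Sum>\<tau><t. slot_expectation N P \<tau> (\<lambda>h s x. cost N s x)) / real t"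
      using eventually_gt_at_top[of 0]
    proof eventually_elim
      case (elim t)
      show ?case
      proof
        assume Qt: "Q t \<le> (e / m) * real t"
        have "(\<Sum>j\<in>UNIV. u $ j * slot_expectation N P t (\<lambda>h s x. backlog N 0 h $ j)) \<le> m * Q t"
          unfolding Q_def sum_distrib_left using m Qj by (intro sum_mono mult_right_mono) auto
        also have "\<dots> \<le> m * ((e / m) * real t)"
          using Qt m by (intro mult_left_mono) auto
        also have "\<dots> = e * real t"
          using m by simp
        finally show "dual N 1 u - e \<le> (\<Sum>\<tau><t. slot_expectation N P \<tau> (\<lambda>h s x. cost N s x)) / real t"
          using policy_cost_lower_bound[OF feas u, of t] elim by (simp add: field_simps)
      qed
    qed
  qed
  then have "ereal (dual N 1 u - e) \<le> average_cost N P"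
    unfolding average_cost_def by (rule time_average_ge_frequently)
  then have "ereal (dual N 1 u - e) + ereal e \<le> average_cost N P + ereal e"
    by (rule add_right_mono)
  then show "ereal (dual N 1 u) \<le> average_cost N P + ereal e"
    by simp
qed

end

section \<open>Drift of the distance to the dual maximizer\<close>

text \<open>
  For negative \<open>y = - z\<close> one has \<open>(1 - z + z\<^sup>2) * (1 + z + z\<^sup>2 / 2) \<ge> 1\<close>, and the second factor is at
  most \<open>exp z\<close>.
\<close>

lemma exp_le_quadratic:
  fixes y :: real
  assumes "\<bar>y\<bar> \<le> 1"
  shows "exp y \<le> 1 + y + y\<^sup>2"
proof (cases "0 \<le> y")
  case True
  then show ?thesis using assms by (intro exp_bound) auto
next
  case False
  define z where "z = - y"
  have z: "0 \<le> z" using False by (simp add: z_def)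
  have "1 + (z\<^sup>2 / 2 + z ^ 3 / 2 + z ^ 4 / 2) = (1 - z + z\<^sup>2) * (1 + z + z\<^sup>2 / 2)"
    by (simp add: field_simps power2_eq_square power3_eq_cube power4_eq_xxxx)
  also have "\<dots> \<le> (1 - z + z\<^sup>2) * exp z"
    using exp_lower_Taylor_quadratic[OF z] zero_le_power2[of "z - 1"] z
    by (intro mult_left_mono) (auto simp: power2_eq_square algebra_simps)
  finally have "1 \<le> (1 - z + z\<^sup>2) * exp z"
    using z by (smt (verit) zero_le_power divide_nonneg_nonneg)
  then have "exp (- z) \<le> 1 - z + z\<^sup>2"
    by (simp add: exp_minus field_simps)
  then show ?thesis by (simp add: z_def)
qed

lemma exp_diff_le:
  fixes a b :: real
  shows "exp b - exp a \<le> exp b * \<bar>b - a\<bar>"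
proof (cases "a \<le> b")
  case True
  have "exp b * (1 + (a - b)) \<le> exp b * exp (a - b)"
    by (intro mult_left_mono exp_ge_add_one_self) auto
  then show ?thesis
    using True by (simp add: algebra_simps flip: exp_add)
next
  case False
  then have "exp b - exp a \<le> 0" by simp
  also have "0 \<le> exp b * \<bar>b - a\<bar>" by simp
  finally show ?thesis .
qed

text \<open>
  The backlog chain of QLA for one value of \<open>V\<close>.  The constants are parameters constrained by
  inequalities, so that it is visible that \<open>\<eta>\<close>, \<open>rad\<close> and \<open>K\<close> can be chosen from \<open>L\<close>, \<open>\<delta>\<close> and the
  number of queues alone.  Here \<open>CARD('r) * \<delta>\<close> bounds the length of a step, \<open>rad\<close> is the radius
  outside of which the linear gain \<open>L * norm (W - Us)\<close> beats the second-order term of the squared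
  distance, \<open>\<eta>\<close> is an exponent small enough for the exponential of the distance to inherit the
  negative drift, and \<open>K\<close> bounds this exponential one step after the chain was inside the ball.
\<close>

locale qla_chain = bounded_network N \<delta>
  for N :: "('s::finite, 'x::topological_space, 'r::finite) network" and \<delta> :: real +
  fixes V :: real and R :: "real^'r \<Rightarrow> 's \<Rightarrow> 'x pmf" and Us :: "real^'r"
    and L \<eta> rad K :: real
  assumes V_ge_1: "1 \<le> V"
    and qla: "qla_rule N V R"
    and Us_nonneg: "\<And>j. 0 \<le> Us $ j"
    and L_pos: "0 < L"
    and dual_sharp: "\<And>U. (\<And>j. 0 \<le> U $ j) \<Longrightarrow> dual N V U + L * norm (U - Us) \<le> dual N V Us"
    and \<eta>_pos: "0 < \<eta>"
    and \<eta>_step: "\<eta> * (CARD('r) * \<delta>) \<le> 1"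
    and \<eta>_small: "4 * \<eta> * (CARD('r) * \<delta>)\<^sup>2 \<le> L"
    and \<eta>_L: "\<eta> * L \<le> 4"
    and rad_ge: "3 * CARD('r) * \<delta>\<^sup>2 \<le> L * rad"
    and K_ge: "exp (\<eta> * (rad + CARD('r) * \<delta>)) \<le> K"
begin

lemma rad_pos: "0 < rad"
proof -
  have "0 < 3 * CARD('r) * \<delta>\<^sup>2"
    using \<delta>_pos by simp
  with rad_ge have "0 < L * rad" by linarith
  then show ?thesis using L_pos by (simp add: zero_less_mult_iff)
qed

abbreviation after :: "real^'r \<Rightarrow> 's \<Rightarrow> 'x \<Rightarrow> real^'r" where
  "after W s x \<equiv> queue_step W (srv N s x) (arr N s x)"

lemma R_feasible: "(\<And>j. 0 \<le> W $ j) \<Longrightarrow> set_pmf (R W s) \<subseteq> feas N s"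
  using qla by (auto simp: qla_rule_def)

lemma after_nonneg: "x \<in> feas N s \<Longrightarrow> 0 \<le> after W s x $ j"
  by (intro queue_step_nonneg arr_nonneg)

lemma norm_after:
  assumes "\<And>j. 0 \<le> W $ j" "x \<in> feas N s"
  shows "norm (after W s x - W) \<le> (\<Sum>j\<in>UNIV. 2 * arr N s x $ j - (after W s x $ j - W $ j))"
    and "norm (after W s x - W) \<le> CARD('r) * \<delta>"
  using norm_queue_step_increment[of W "srv N s x" \<delta> "arr N s x"] assms arr_bounded srv_bounded by auto

lemma distance_after:
  assumes "\<And>j. 0 \<le> W $ j" "x \<in> feas N s"
  shows "\<bar>norm (after W s x - u) - norm (W - u)\<bar> \<le> norm (after W s x - W)"
    and "\<bar>norm (after W s x - u) - norm (W - u)\<bar> \<le> CARD('r) * \<delta>"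
proof -
  show "\<bar>norm (after W s x - u) - norm (W - u)\<bar> \<le> norm (after W s x - W)"
    using norm_triangle_ineq3[of "after W s x - u" "W - u"] by simp
  then show "\<bar>norm (after W s x - u) - norm (W - u)\<bar> \<le> CARD('r) * \<delta>"
    using norm_after(2)[of W x s] assms by simp
qed

lemma distance_square_after:
  assumes "\<And>j. 0 \<le> W $ j" "\<And>j. 0 \<le> u $ j" "x \<in> feas N s"
  shows "(norm (after W s x - u))\<^sup>2 \<le> (norm (W - u))\<^sup>2 + 3 * CARD('r) * \<delta>\<^sup>2
    + 2 * (lagrangian N V W s x - lagrangian N V u s x)"
proof -
  have "(\<Sum>j\<in>UNIV. (W $ j - u $ j) * (arr N s x $ j - srv N s x $ j)) = lagrangian N V W s x - lagrangian N V u s x"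
    by (simp add: lagrangian_def left_diff_distrib sum_subtractf)
  then show ?thesis
    using queue_step_quadratic[of W u "srv N s x" \<delta> "arr N s x"] assms arr_bounded srv_bounded by simp
qed

text \<open>
  QLA attains the dual value at its own backlog \<open>W\<close>, and its decision is merely admissible for the
  dual problem at \<open>Us\<close>.  So the expected gap is at most the difference of the dual values, which is
  controlled by the sharp maximum.
\<close>

lemma expectation_lagrangian_gap:
  assumes W: "\<And>j. 0 \<le> W $ j"
  shows "measure_pmf.expectation (action_pmf N (R W)) (\<lambda>(s, x). lagrangian N V W s x - lagrangian N V Us s x)
    \<le> - L * norm (W - Us)"
proof -
  have bnd: "x \<in> feas N s" if "(s, x) \<in> set_pmf (action_pmf N (R W))" for s x
    using R_feasible[OF W] action_pmf_support[OF that] by blast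
  have int: "integrable (action_pmf N (R W)) (\<lambda>(s, x). lagrangian N V U s x)" for U
    using bnd abs_lagrangian_le by (intro integrable_pmf_bounded[where B = "lag_bound V U"]) auto
  have "measure_pmf.expectation (action_pmf N (R W)) (\<lambda>(s, x). lagrangian N V W s x - lagrangian N V Us s x) =
      measure_pmf.expectation (action_pmf N (R W)) (\<lambda>(s, x). lagrangian N V W s x) -
      measure_pmf.expectation (action_pmf N (R W)) (\<lambda>(s, x). lagrangian N V Us s x)"
    using Bochner_Integration.integral_diff[OF int[of W] int[of Us]] by (simp add: case_prod_unfold)
  also have "\<dots> \<le> dual N V W - dual N V Us"
    using qla_expectation_le_dual[OF qla W] dual_le_expectation[of "R W" V Us] R_feasible[OF W] by simp
  finally show ?thesis using dual_sharp[OF W] by simp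
qed

text \<open>
  From \<open>2 * Y * (Y' - Y) \<le> Y'\<^sup>2 - Y\<^sup>2\<close> a drift of the squared distance gives one of the
  distance itself after division by \<open>2 * Y\<close>; outside the ball the second-order term costs at most
  half of \<open>L\<close>.
\<close>

lemma distance_drift:
  assumes W: "\<And>j. 0 \<le> W $ j" and far: "rad \<le> norm (W - Us)"
  shows "measure_pmf.expectation (action_pmf N (R W)) (\<lambda>(s, x). norm (after W s x - Us) - norm (W - Us)) \<le> - L / 2"
proof -
  define Y where "Y = norm (W - Us)"
  define B where "B = 3 * CARD('r) * \<delta>\<^sup>2"
  have Y: "rad \<le> Y" "0 < Y" using far rad_pos by (auto simp: Y_def)
  have BY: "B \<le> L * Y"
    unfolding B_def using rad_ge mult_left_mono[OF Y(1), of L] L_pos by linarith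
  have "measure_pmf.expectation (action_pmf N (R W)) (\<lambda>(s, x). norm (after W s x - Us) - norm (W - Us))
      \<le> B / (2 * Y) + 1 / Y * measure_pmf.expectation (action_pmf N (R W))
          (\<lambda>(s, x). lagrangian N V W s x - lagrangian N V Us s x)"
  proof (rule action_expectation_affine_le[OF R_feasible[OF W] distance_after(2)[OF W]])
    fix s x assume x: "x \<in> feas N s"
    show "\<bar>lagrangian N V W s x - lagrangian N V Us s x\<bar> \<le> lag_bound V W + lag_bound V Us"
      using abs_lagrangian_le[OF x, of V W] abs_lagrangian_le[OF x, of V Us] by linarith
    define Y' where "Y' = norm (after W s x - Us)"
    have "2 * Y * (Y' - Y) \<le> Y'\<^sup>2 - Y\<^sup>2"
      using zero_le_power2[of "Y' - Y"] by (simp add: power2_eq_square algebra_simps)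
    also have "\<dots> \<le> B + 2 * (lagrangian N V W s x - lagrangian N V Us s x)"
      using distance_square_after[OF W Us_nonneg x] by (simp add: Y'_def Y_def B_def)
    finally have "Y' - Y \<le> B / (2 * Y) + 1 / Y * (lagrangian N V W s x - lagrangian N V Us s x)"
      using Y by (simp add: field_simps)
    then show "norm (after W s x - Us) - norm (W - Us)
        \<le> B / (2 * Y) + 1 / Y * (lagrangian N V W s x - lagrangian N V Us s x)"
      by (simp add: Y'_def Y_def)
  qed auto
  also have "\<dots> \<le> (L * Y) / (2 * Y) + 1 / Y * (- L * Y)"
    using BY Y expectation_lagrangian_gap[OF W] unfolding Y_def
    by (intro add_mono divide_right_mono mult_left_mono) auto
  also have "\<dots> = - L / 2" using Y by simp
  finally show ?thesis .
qed

text \<open>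
  Second-order expansion of the exponential: the steps are bounded, so the quadratic term is at
  most \<open>\<eta> * L / 4\<close>, half of what the linear drift \<open>- \<eta> * L / 2\<close> gains.
\<close>

lemma exp_drift_far:
  assumes W: "\<And>j. 0 \<le> W $ j" and far: "rad \<le> norm (W - Us)"
  shows "measure_pmf.expectation (action_pmf N (R W)) (\<lambda>(s, x). exp (\<eta> * norm (after W s x - Us)))
    \<le> (1 - \<eta> * L / 4) * exp (\<eta> * norm (W - Us))"
proof -
  define Y where "Y = norm (W - Us)"
  have step: "\<bar>norm (after W s x - Us) - Y\<bar> \<le> CARD('r) * \<delta>" if "x \<in> feas N s" for s x
    using distance_after(2)[OF W that, of Us] by (simp add: Y_def)
  have "measure_pmf.expectation (action_pmf N (R W)) (\<lambda>(s, x). exp (\<eta> * norm (after W s x - Us)))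
      \<le> exp (\<eta> * Y) * (1 + \<eta> * L / 4) + (exp (\<eta> * Y) * \<eta>) * measure_pmf.expectation (action_pmf N (R W))
          (\<lambda>(s, x). norm (after W s x - Us) - norm (W - Us))"
  proof (rule action_expectation_affine_le[OF R_feasible[OF W] _ distance_after(2)[OF W]])
    fix s x assume x: "x \<in> feas N s"
    define y where "y = \<eta> * (norm (after W s x - Us) - Y)"
    have y_abs: "\<bar>y\<bar> \<le> \<eta> * (CARD('r) * \<delta>)"
      using step[OF x] \<eta>_pos by (simp add: y_def abs_mult mult_left_mono)
    have "y\<^sup>2 \<le> (\<eta> * (CARD('r) * \<delta>))\<^sup>2"
      using y_abs by (rule abs_le_square_iff[THEN iffD1, OF order_trans[OF _ abs_ge_self]])
    also have "\<dots> = \<eta> * (4 * \<eta> * (CARD('r) * \<delta>)\<^sup>2) / 4"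
      by (simp add: power2_eq_square)
    also have "\<dots> \<le> \<eta> * L / 4"
      using \<eta>_small \<eta>_pos by (intro divide_right_mono mult_left_mono) auto
    finally have y_sq: "y\<^sup>2 \<le> \<eta> * L / 4" .
    have "exp y \<le> 1 + y + y\<^sup>2"
      using y_abs \<eta>_step by (intro exp_le_quadratic) linarith
    with y_sq have "exp y \<le> 1 + \<eta> * L / 4 + y" by linarith
    then have "exp (\<eta> * Y) * exp y \<le> exp (\<eta> * Y) * (1 + \<eta> * L / 4 + y)"
      by (intro mult_left_mono) auto
    then show "exp (\<eta> * norm (after W s x - Us)) \<le> exp (\<eta> * Y) * (1 + \<eta> * L / 4)
        + exp (\<eta> * Y) * \<eta> * (norm (after W s x - Us) - norm (W - Us))"
      by (simp add: y_def Y_def algebra_simps flip: exp_add)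
    show "\<bar>exp (\<eta> * norm (after W s x - Us))\<bar> \<le> exp (\<eta> * (Y + CARD('r) * \<delta>))"
      using step[OF x] \<eta>_pos by simp
  qed auto
  also have "\<dots> \<le> exp (\<eta> * Y) * (1 + \<eta> * L / 4) + (exp (\<eta> * Y) * \<eta>) * (- L / 2)"
    using distance_drift[OF W far] \<eta>_pos by (intro add_left_mono mult_left_mono) auto
  finally show ?thesis by (simp add: Y_def algebra_simps)
qed

lemma exp_after_near:
  assumes W: "\<And>j. 0 \<le> W $ j" and near: "norm (W - Us) < rad" and x: "x \<in> feas N s"
  shows "exp (\<eta> * norm (after W s x - Us)) \<le> K"
proof -
  have "exp (\<eta> * norm (after W s x - Us)) \<le> exp (\<eta> * (rad + CARD('r) * \<delta>))"
    using distance_after(2)[OF W x, of Us] near \<eta>_pos by simp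
  then show ?thesis using K_ge by linarith
qed

lemma K_pos: "0 < K"
  using K_ge exp_gt_zero less_le_trans by blast

lemma exp_drift:
  assumes W: "\<And>j. 0 \<le> W $ j"
  shows "measure_pmf.expectation (action_pmf N (R W)) (\<lambda>(s, x). exp (\<eta> * norm (after W s x - Us)))
    \<le> (1 - \<eta> * L / 4) * exp (\<eta> * norm (W - Us)) + K"
proof (cases "rad \<le> norm (W - Us)")
  case True
  then show ?thesis using exp_drift_far[OF W] K_pos by fastforce
next
  case False
  have "measure_pmf.expectation (action_pmf N (R W)) (\<lambda>(s, x). exp (\<eta> * norm (after W s x - Us))) \<le> K"
    using R_feasible[OF W] exp_after_near[OF W] False action_pmf_support
    by (intro expectation_le_pmf[where B = K]) fastforce+
  moreover have "0 \<le> (1 - \<eta> * L / 4) * exp (\<eta> * norm (W - Us))"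
    using \<eta>_L by simp
  ultimately show ?thesis by linarith
qed

section \<open>Concentration in steady state\<close>

text \<open>
  Stationarity and the drift give \<open>\<kappa> * E \<phi> \<le> K\<close> formally, but \<open>E \<phi>\<close> is not known to be finite.
  Hence the argument is run for \<open>min \<phi> M\<close>, whose stationary expectation does not change in one
  step.  The expected decrease of \<open>min \<phi> M\<close> is nonnegative where \<open>\<phi> \<ge> M\<close> and at least \<open>\<kappa> * \<phi> - K\<close>
  elsewhere, which bounds the probability of \<open>c \<le> \<phi> < M\<close> uniformly in \<open>M\<close>.
\<close>

lemma steady_state_tail:
  assumes D: "steady_state N R D" and c: "0 < c"
  shows "measure_pmf.prob D {w. c \<le> exp (\<eta> * norm (w - Us))} \<le> 4 * K / (\<eta> * L * c)"
proof -
  define \<kappa> where "\<kappa> = \<eta> * L / 4"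
  define \<phi> where "\<phi> w = exp (\<eta> * norm (w - Us))" for w
  have \<kappa>: "0 < \<kappa>" "\<kappa> \<le> 1" using \<eta>_pos L_pos \<eta>_L by (auto simp: \<kappa>_def)
  have D_nonneg: "0 \<le> w $ j" if "w \<in> set_pmf D" for w j
    using D that by (simp add: steady_state_def)
  have D_eq: "bind_pmf D (\<lambda>W. map_pmf (\<lambda>(s, x). after W s x) (action_pmf N (R W))) = D"
    using D by (simp add: steady_state_def action_pmf_def map_bind_pmf)
  have below: "measure_pmf.prob D {w. c \<le> \<phi> w \<and> \<phi> w < M} \<le> K / (\<kappa> * c)" if M: "0 < M" for M
  proof -
    define g where "g w = min (\<phi> w) M" for w
    have g: "0 \<le> g w" "g w \<le> M" for w using M by (auto simp: g_def \<phi>_def)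
    define H where "H w = min ((1 - \<kappa>) * \<phi> w + K) M" for w
    have H: "\<bar>H w\<bar> \<le> M" for w
      using \<kappa> K_pos M by (auto simp: H_def \<phi>_def abs_le_iff min_def)
    have "measure_pmf.expectation D g = measure_pmf.expectation D
        (\<lambda>W. measure_pmf.expectation (action_pmf N (R W)) (\<lambda>(s, x). g (after W s x)))"
      by (subst (1) D_eq[symmetric], subst expectation_bind_pmf[where B = M])
         (use g in \<open>auto simp: case_prod_unfold\<close>)
    also have "\<dots> \<le> measure_pmf.expectation D H"
    proof (rule expectation_mono_pmf[where B = M and B' = M])
      fix W assume "W \<in> set_pmf D"
      then have W: "\<And>j. 0 \<le> W $ j" using D_nonneg by auto
      have le_M: "measure_pmf.expectation (action_pmf N (R W)) (\<lambda>(s, x). g (after W s x)) \<le> M"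
        using g by (intro expectation_le_pmf[where B = M]) auto
      have "measure_pmf.expectation (action_pmf N (R W)) (\<lambda>(s, x). g (after W s x))
          \<le> 0 + 1 * measure_pmf.expectation (action_pmf N (R W)) (\<lambda>(s, x). \<phi> (after W s x))"
      proof (rule action_expectation_affine_le[OF R_feasible[OF W]])
        fix s x assume x: "x \<in> feas N s"
        show "\<bar>g (after W s x)\<bar> \<le> M" using g by simp
        show "\<bar>\<phi> (after W s x)\<bar> \<le> exp (\<eta> * (norm (W - Us) + CARD('r) * \<delta>))"
          using distance_after(2)[OF W x, of Us] \<eta>_pos by (simp add: \<phi>_def)
        show "g (after W s x) \<le> 0 + 1 * \<phi> (after W s x)" by (simp add: g_def)
      qed
      moreover have "\<dots> \<le> (1 - \<kappa>) * \<phi> W + K"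
        using exp_drift[OF W] by (simp add: \<phi>_def \<kappa>_def)
      ultimately show "measure_pmf.expectation (action_pmf N (R W)) (\<lambda>(s, x). g (after W s x)) \<le> H W"
        using le_M by (simp add: H_def)
      have "0 \<le> measure_pmf.expectation (action_pmf N (R W)) (\<lambda>(s, x). g (after W s x))"
        using g by (intro integral_nonneg_AE) auto
      then show "\<bar>measure_pmf.expectation (action_pmf N (R W)) (\<lambda>(s, x). g (after W s x))\<bar> \<le> M"
        using le_M by simp
    qed (use H in auto)
    finally have gH: "measure_pmf.expectation D g \<le> measure_pmf.expectation D H" .
    have int: "integrable D g" "integrable D H"
      using g H by (auto intro!: integrable_pmf_bounded[where B = M])
    have ind: "integrable D (indicator {w. c \<le> \<phi> w \<and> \<phi> w < M} :: _ \<Rightarrow> real)"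
      by (intro integrable_pmf_bounded[where B = 1]) (auto simp: indicator_def)
    have "\<kappa> * c * measure_pmf.prob D {w. c \<le> \<phi> w \<and> \<phi> w < M} - K =
        measure_pmf.expectation D (\<lambda>w. \<kappa> * c * indicator {w. c \<le> \<phi> w \<and> \<phi> w < M} w - K)"
      using ind by (subst Bochner_Integration.integral_diff) auto
    also have "\<dots> \<le> measure_pmf.expectation D (\<lambda>w. g w - H w)"
    proof (rule expectation_mono_pmf)
      fix w
      show "\<bar>\<kappa> * c * indicator {w. c \<le> \<phi> w \<and> \<phi> w < M} w - K\<bar> \<le> \<kappa> * c + K"
        using mult_pos_pos[OF \<kappa>(1) c] K_pos by (auto simp: indicator_def abs_le_iff)
      show "\<bar>g w - H w\<bar> \<le> M + M"
        using g[of w] H[of w] by linarith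
      show "\<kappa> * c * indicator {w. c \<le> \<phi> w \<and> \<phi> w < M} w - K \<le> g w - H w"
      proof (cases "\<phi> w < M")
        case True
        have "g w - H w \<ge> \<kappa> * \<phi> w - K"
          using True by (auto simp: g_def H_def min_def algebra_simps)
        moreover have "\<kappa> * c * indicator {w. c \<le> \<phi> w \<and> \<phi> w < M} w \<le> \<kappa> * \<phi> w"
          using \<kappa> by (auto simp: indicator_def \<phi>_def)
        ultimately show ?thesis by linarith
      next
        case False
        then have "0 \<le> g w - H w" by (simp add: g_def H_def)
        then show ?thesis using False K_pos by (simp add: indicator_def)
      qed
    qed
    also have "\<dots> = measure_pmf.expectation D g - measure_pmf.expectation D H"
      using int by (rule Bochner_Integration.integral_diff)
    finally have "\<kappa> * c * measure_pmf.prob D {w. c \<le> \<phi> w \<and> \<phi> w < M} \<le> K"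
      using gH by linarith
    then show ?thesis
      using \<kappa> c by (simp add: field_simps)
  qed
  have "(\<lambda>n. measure_pmf.prob D {w. c \<le> \<phi> w \<and> \<phi> w < real (Suc n)})
      \<longlonglongrightarrow> measure_pmf.prob D (\<Union>n. {w. c \<le> \<phi> w \<and> \<phi> w < real (Suc n)})"
    by (rule measure_pmf.finite_Lim_measure_incseq) (auto simp: incseq_def)
  moreover have "(\<Union>n. {w. c \<le> \<phi> w \<and> \<phi> w < real (Suc n)}) = {w. c \<le> \<phi> w}"
  proof -
    have "\<exists>n. \<phi> w < real (Suc n)" for w
      using reals_Archimedean2[of "\<phi> w"] by (metis lessI less_trans of_nat_less_iff)
    then show ?thesis by auto
  qed
  ultimately have "(\<lambda>n. measure_pmf.prob D {w. c \<le> \<phi> w \<and> \<phi> w < real (Suc n)})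
      \<longlonglongrightarrow> measure_pmf.prob D {w. c \<le> \<phi> w}"
    by simp
  then have "measure_pmf.prob D {w. c \<le> \<phi> w} \<le> K / (\<kappa> * c)"
    by (rule LIMSEQ_le_const2) (use below in auto)
  then show ?thesis by (simp add: \<phi>_def \<kappa>_def field_simps)
qed

end

section \<open>The placeholder recursion\<close>

lemma fqla_state_Nil [simp]: "fqla_state N \<W> [] = (0, \<W>)"
  by (simp add: fqla_state_def)

lemma fqla_state_snoc:
  "fqla_state N \<W> (h @ [(s, x)]) =
    (queue_step (fst (fqla_state N \<W> h)) (srv N s x) (admitted N \<W> (snd (fqla_state N \<W> h)) s x),
     queue_step (snd (fqla_state N \<W> h)) (srv N s x) (arr N s x))"
  by (simp add: fqla_state_def case_prod_unfold)

lemma snd_fqla_state [simp]: "snd (fqla_state N \<W> h) = backlog N \<W> h"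
  by (induction h rule: rev_induct) (auto simp: fqla_state_snoc)

text \<open>
  One step of the comparison of a real queue \<open>u\<close> with the placeholder queue \<open>w\<close> of level \<open>l\<close>.  Since
  \<open>m \<le> d\<close>, the slack \<open>d\<close> absorbs a slot in which the real queue is served but \<open>w\<close> is at its level or
  below.  Below the level, the admitted part of \<open>a\<close> is what would lift \<open>w\<close> above the level without
  service.
\<close>

lemma scalar_placeholder_step:
  fixes u w l m a d :: real
  assumes "0 \<le> w" "0 \<le> m" "m \<le> d" "0 \<le> a" "a \<le> d" "u \<le> max (w - l) 0 + d"
  shows "max (u - m) 0 + (if l \<le> w then a else max (a - l + w) 0) \<le> max (max (w - m) 0 + a - l) 0 + d"
  using assms by (smt (verit))

context bounded_network
begin

lemma admitted_bounds:
  assumes "x \<in> feas N s"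
  shows "0 \<le> admitted N \<W> W s x $ j" "admitted N \<W> W s x $ j \<le> arr N s x $ j"
  using arr_nonneg[OF assms, of j] by (auto simp: admitted_def)

lemma fqla_backlog_bounds:
  assumes h: "feasible_history N h" and \<W>: "\<And>j. 0 \<le> \<W> $ j"
  shows "0 \<le> fst (fqla_state N \<W> h) $ j \<and>
    fst (fqla_state N \<W> h) $ j \<le> max (backlog N \<W> h $ j - \<W> $ j) 0 + \<delta>"
  using h
proof (induction h rule: feasible_history_induct)
  case Nil
  then show ?case using \<delta>_pos by simp
next
  case (snoc h s x)
  have "fst (fqla_state N \<W> (h @ [(s, x)])) $ j \<le> max (backlog N \<W> (h @ [(s, x)]) $ j - \<W> $ j) 0 + \<delta>"
    using scalar_placeholder_step[where d = \<delta> and l = "\<W> $ j" and u = "fst (fqla_state N \<W> h) $ j"]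
      snoc backlog_nonneg[OF snoc(1) \<W>, of j] arr_bounded[OF snoc(2), of j] srv_bounded[OF snoc(2), of j]
    by (simp add: fqla_state_snoc admitted_def)
  moreover have "0 \<le> fst (fqla_state N \<W> (h @ [(s, x)])) $ j"
    using admitted_bounds(1)[OF snoc(2)] by (simp add: fqla_state_snoc)
  ultimately show ?case by blast
qed

end

section \<open>Charging time far from the dual maximizer to arrivals\<close>

context qla_chain
begin

text \<open>
  The part of the exponential that lies outside the ball.  Its accumulated expectation controls
  both the backlog and the dropped packets.
\<close>

definition excess :: "real^'r \<Rightarrow> real" where
  "excess W = (if rad \<le> norm (W - Us) then exp (\<eta> * norm (W - Us)) else 0)"

lemma excess_nonneg: "0 \<le> excess W"
  by (simp add: excess_def)

lemma norm_le_excess: "norm (W - Us) \<le> rad + excess W / \<eta>"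
proof (cases "rad \<le> norm (W - Us)")
  case True
  have "\<eta> * norm (W - Us) \<le> exp (\<eta> * norm (W - Us))"
    using exp_ge_add_one_self[of "\<eta> * norm (W - Us)"] by linarith
  then have "norm (W - Us) \<le> excess W / \<eta>"
    using \<eta>_pos True by (simp add: excess_def field_simps)
  then show ?thesis using rad_pos by linarith
qed (simp add: excess_def)

text \<open>
  Inside the ball the exponential may increase by as much as \<open>\<eta> * K\<close> times the distance moved.  The
  linear term compensates the moves that are due to departures, so that only arrivals can increase
  the sum.
\<close>

definition potential :: "real^'r \<Rightarrow> real" where
  "potential W = exp (\<eta> * norm (W - Us)) + \<eta> * K * (\<Sum>j\<in>UNIV. W $ j)"

lemma potential_nonneg: "(\<And>j. 0 \<le> W $ j) \<Longrightarrow> 0 \<le> potential W"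
  using \<eta>_pos K_pos by (auto simp: potential_def intro!: add_nonneg_nonneg mult_nonneg_nonneg sum_nonneg)

lemma potential_after_near:
  assumes W: "\<And>j. 0 \<le> W $ j" and near: "norm (W - Us) < rad" and x: "x \<in> feas N s"
  shows "potential (after W s x) \<le> potential W + 2 * \<eta> * K * (\<Sum>j\<in>UNIV. arr N s x $ j)"
proof -
  let ?Y = "norm (W - Us)" and ?Y' = "norm (after W s x - Us)"
  have "exp (\<eta> * ?Y') - exp (\<eta> * ?Y) \<le> exp (\<eta> * ?Y') * \<bar>\<eta> * ?Y' - \<eta> * ?Y\<bar>"
    by (rule exp_diff_le)
  also have "\<dots> \<le> K * \<bar>\<eta> * ?Y' - \<eta> * ?Y\<bar>"
    by (intro mult_right_mono exp_after_near[OF W near x]) auto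
  also have "\<dots> = \<eta> * K * \<bar>?Y' - ?Y\<bar>"
    using \<eta>_pos by (simp add: abs_mult flip: right_diff_distrib)
  also have "\<dots> \<le> \<eta> * K * (\<Sum>j\<in>UNIV. 2 * arr N s x $ j - (after W s x $ j - W $ j))"
    using distance_after(1)[OF W x, of Us] norm_after(1)[OF W x] \<eta>_pos K_pos
    by (intro mult_left_mono) auto
  also have "\<dots> = \<eta> * K * (2 * (\<Sum>j\<in>UNIV. arr N s x $ j) - ((\<Sum>j\<in>UNIV. after W s x $ j) - (\<Sum>j\<in>UNIV. W $ j)))"
    by (simp only: sum_subtractf sum_distrib_left)
  finally show ?thesis by (simp add: potential_def algebra_simps del: queue_step_nth)
qed

lemma sum_after_le:
  assumes "\<And>j. 0 \<le> W $ j" "x \<in> feas N s"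
  shows "(\<Sum>j\<in>UNIV. after W s x $ j) \<le> (\<Sum>j\<in>UNIV. W $ j) + (\<Sum>j\<in>UNIV. arr N s x $ j)"
  unfolding sum.distrib[symmetric] using assms srv_nonneg by (intro sum_mono) (auto simp: max_def)

text \<open>
  Outside the ball the exponential shrinks by a fixed fraction.  Inside it the potential increases
  at most in proportion to the arrivals, not by a constant per slot.  This is what makes a
  comparison of drops with generated packets possible, however rarely packets are generated.
\<close>

lemma potential_drift:
  assumes W: "\<And>j. 0 \<le> W $ j"
  shows "measure_pmf.expectation (action_pmf N (R W)) (\<lambda>(s, x).
      potential (after W s x) + (\<eta> * L / 4 * excess W - 2 * \<eta> * K * (\<Sum>j\<in>UNIV. arr N s x $ j)))
    \<le> potential W"
proof -
  define F where "F s x = potential (after W s x) + (\<eta> * L / 4 * excess W - 2 * \<eta> * K * (\<Sum>j\<in>UNIV. arr N s x $ j))" for s x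
  define S where "S = (\<Sum>j\<in>UNIV. W $ j)"
  have S: "0 \<le> S" using W by (auto simp: S_def intro: sum_nonneg)
  have exp_bd: "\<bar>exp (\<eta> * norm (after W s x - Us))\<bar> \<le> exp (\<eta> * (norm (W - Us) + CARD('r) * \<delta>))"
    if "x \<in> feas N s" for s x
    using distance_after(2)[OF W that, of Us] \<eta>_pos by simp
  define A where "A = CARD('r) * \<delta>"
  have arr: "0 \<le> (\<Sum>j\<in>UNIV. arr N s x $ j)" "(\<Sum>j\<in>UNIV. arr N s x $ j) \<le> A" if "x \<in> feas N s" for s x
    using that arr_nonneg sum_bounded_above[of UNIV "\<lambda>j. arr N s x $ j" \<delta>] arr_le
    by (auto simp: A_def intro!: sum_nonneg)
  have after: "0 \<le> (\<Sum>j\<in>UNIV. after W s x $ j)" if "x \<in> feas N s" for s x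
    using after_nonneg[OF that] by (rule sum_nonneg)
  have K0: "0 \<le> \<eta> * K" using \<eta>_pos K_pos by simp
  have F_bd: "\<bar>F s x\<bar> \<le> exp (\<eta> * (norm (W - Us) + CARD('r) * \<delta>)) + \<eta> * K * (S + A) + \<bar>\<eta> * L / 4 * excess W\<bar> + \<eta> * K * (2 * A)"
    if x: "x \<in> feas N s" for s x
  proof -
    have "\<eta> * K * (\<Sum>j\<in>UNIV. after W s x $ j) \<le> \<eta> * K * (S + A)"
      using K0 sum_after_le[OF W x] arr[OF x] by (intro mult_left_mono) (auto simp: S_def)
    moreover have "0 \<le> \<eta> * K * (\<Sum>j\<in>UNIV. after W s x $ j)"
      by (rule mult_nonneg_nonneg[OF K0 after[OF x]])
    moreover have "\<eta> * K * (2 * (\<Sum>j\<in>UNIV. arr N s x $ j)) \<le> \<eta> * K * (2 * A)"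
      using K0 arr[OF x] by (intro mult_left_mono) auto
    moreover have "0 \<le> \<eta> * K * (2 * (\<Sum>j\<in>UNIV. arr N s x $ j))"
      using arr[OF x] by (intro mult_nonneg_nonneg[OF K0]) simp
    moreover have "F s x = exp (\<eta> * norm (after W s x - Us)) + \<eta> * K * (\<Sum>j\<in>UNIV. after W s x $ j)
        + \<eta> * L / 4 * excess W - \<eta> * K * (2 * (\<Sum>j\<in>UNIV. arr N s x $ j))"
      by (simp add: F_def potential_def del: queue_step_nth)
    ultimately show ?thesis using exp_bd[OF x] by linarith
  qed
  have "measure_pmf.expectation (action_pmf N (R W)) (\<lambda>(s, x). F s x) \<le> potential W"
  proof (cases "rad \<le> norm (W - Us)")
    case True
    have "measure_pmf.expectation (action_pmf N (R W)) (\<lambda>(s, x). F s x)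
        \<le> (\<eta> * K * S + \<eta> * L / 4 * excess W) + 1 *
          measure_pmf.expectation (action_pmf N (R W)) (\<lambda>(s, x). exp (\<eta> * norm (after W s x - Us)))"
    proof (rule action_expectation_affine_le[OF R_feasible[OF W] F_bd exp_bd])
      fix s x assume x: "x \<in> feas N s"
      have "\<eta> * K * (\<Sum>j\<in>UNIV. after W s x $ j) \<le> \<eta> * K * (S + 2 * (\<Sum>j\<in>UNIV. arr N s x $ j))"
        using K0 sum_after_le[OF W x] arr[OF x] by (intro mult_left_mono) (auto simp: S_def)
      then show "F s x \<le> \<eta> * K * S + \<eta> * L / 4 * excess W + 1 * exp (\<eta> * norm (after W s x - Us))"
        by (simp add: F_def potential_def algebra_simps del: queue_step_nth)
    qed
    also have "\<dots> \<le> (\<eta> * K * S + \<eta> * L / 4 * excess W) + 1 * ((1 - \<eta> * L / 4) * exp (\<eta> * norm (W - Us)))"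
      using exp_drift_far[OF W True] by simp
    also have "\<dots> = potential W"
      using True by (simp add: excess_def potential_def S_def algebra_simps)
    finally show ?thesis .
  next
    case False
    have "measure_pmf.expectation (action_pmf N (R W)) (\<lambda>(s, x). F s x)
        \<le> potential W + 0 * measure_pmf.expectation (action_pmf N (R W)) (\<lambda>(s, x). 0)"
    proof (rule action_expectation_affine_le[OF R_feasible[OF W] F_bd])
      fix s x assume x: "x \<in> feas N s"
      show "F s x \<le> potential W + 0 * 0"
        using potential_after_near[OF W _ x] False by (simp add: F_def excess_def)
    qed auto
    then show ?thesis by simp
  qed
  then show ?thesis by (simp add: F_def)
qed

section \<open>Long-run behaviour of FQLA\<close>

lemma fqla_policy_backlog: "fqla_policy N R \<W> h s = R (backlog N \<W> h) s"
  by (simp add: fqla_policy_def)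

lemma fqla_policy_feasible:
  assumes "\<And>j. 0 \<le> \<W> $ j"
  shows "feasible_policy N (fqla_policy N R \<W>)"
  unfolding feasible_policy_def fqla_policy_backlog
  using R_feasible backlog_nonneg assms by metis

lemma slot_bounded_excess:
  assumes "\<And>j. 0 \<le> \<W> $ j"
  shows "slot_bounded N (\<lambda>h s x. excess (backlog N \<W> h))"
proof (rule slot_boundedI)
  fix h s x assume "feasible_history N h"
  then show "\<bar>excess (backlog N \<W> h)\<bar> \<le> exp (\<eta> * (norm (\<W> - Us) + length h * (CARD('r) * \<delta>)))"
    using norm_backlog_le[OF _ assms, of h Us] \<eta>_pos by (simp add: excess_def)
qed

lemma slot_bounded_potential:
  assumes "\<And>j. 0 \<le> \<W> $ j"
  shows "slot_bounded N (\<lambda>h s x. potential (backlog N \<W> h))"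
  unfolding potential_def
proof (intro slot_bounded_intros slot_bounded_backlog[OF assms])
  show "slot_bounded N (\<lambda>h s x. exp (\<eta> * norm (backlog N \<W> h - Us)))"
  proof (rule slot_boundedI)
    fix h s x assume "feasible_history N h"
    then show "\<bar>exp (\<eta> * norm (backlog N \<W> h - Us))\<bar>
        \<le> exp (\<eta> * (norm (\<W> - Us) + length h * (CARD('r) * \<delta>)))"
      using norm_backlog_le[OF _ assms, of h Us] \<eta>_pos by simp
  qed
qed

lemma slot_bounded_fqla_backlog:
  assumes "\<And>j. 0 \<le> \<W> $ j"
  shows "slot_bounded N (\<lambda>h s x. fst (fqla_state N \<W> h) $ j)"
proof (rule slot_boundedI)
  fix h s x assume h: "feasible_history N h"
  have "backlog N \<W> h $ j \<le> norm (\<W> - 0) + length h * (CARD('r) * \<delta>)"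
    using norm_backlog_le[OF h assms, of 0] component_le_norm_cart[of "backlog N \<W> h" j] by simp
  moreover have "0 \<le> length h * (CARD('r) * \<delta>)"
    using \<delta>_pos by simp
  ultimately show "\<bar>fst (fqla_state N \<W> h) $ j\<bar> \<le> norm (\<W> - 0) + length h * (CARD('r) * \<delta>) + \<delta>"
    using fqla_backlog_bounds[OF h assms, of j] assms[of j] \<delta>_pos
      norm_ge_zero[of "\<W> - 0"] by linarith
qed

lemma slot_bounded_dropped:
  "slot_bounded N (\<lambda>h s x. arr N s x $ j - admitted N \<W> (snd (fqla_state N \<W> h)) s x $ j)"
proof (rule slot_boundedI)
  fix h :: "('s \<times> 'x) list" and s x assume x: "x \<in> feas N s"
  show "\<bar>arr N s x $ j - admitted N \<W> (snd (fqla_state N \<W> h)) s x $ j\<bar> \<le> \<delta>"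
    using admitted_bounds[OF x, of \<W> "snd (fqla_state N \<W> h)" j] arr_le[OF x, of j] by linarith
qed

definition expected_excess :: "real^'r \<Rightarrow> nat \<Rightarrow> real" where
  "expected_excess \<W> \<tau> = slot_expectation N (fqla_policy N R \<W>) \<tau> (\<lambda>h s x. excess (backlog N \<W> h))"

text \<open>
  Time spent far from \<open>Us\<close>, weighted exponentially, is paid for by generated packets, up to the
  initial potential.
\<close>

lemma excess_occupation:
  assumes \<W>: "\<And>j. 0 \<le> \<W> $ j"
  shows "\<eta> * L / 4 * (\<Sum>\<tau><t. expected_excess \<W> \<tau>)
    \<le> potential \<W> + 2 * \<eta> * K * expected_generated N R \<W> t"
proof -
  define P where "P = fqla_policy N R \<W>"
  have P: "feasible_policy N P"
    unfolding P_def by (rule fqla_policy_feasible[OF \<W>])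
  define A where "A s x = (\<Sum>j\<in>UNIV. arr N s x $ j)" for s x
  have A: "slot_bounded N (\<lambda>h s x. A s x)"
    unfolding A_def by (intro slot_bounded_sum slot_bounded_arr)
  define G where "G h s x = \<eta> * L / 4 * excess (backlog N \<W> h) + - (2 * \<eta> * K) * A s x" for h s x
  have G: "slot_bounded N G"
    unfolding G_def by (intro slot_bounded_intros slot_bounded_excess[OF \<W>] A)
  have "measure_pmf.expectation (history_pmf N P t) (\<lambda>h. potential (backlog N \<W> h))
      + (\<Sum>\<tau><t. slot_expectation N P \<tau> G) \<le> potential (backlog N \<W> []) + 0 * real t"
  proof (rule telescoped_drift[OF P slot_bounded_potential[OF \<W>] G])
    fix h assume "feasible_history N h"
    then show "measure_pmf.expectation (action_pmf N (P h)) (\<lambda>(s, x). potential (backlog N \<W> (h @ [(s, x)])) + G h s x)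
        \<le> potential (backlog N \<W> h) + 0"
      using potential_drift[of "backlog N \<W> h"] backlog_nonneg[OF _ \<W>, of h]
      by (simp add: P_def fqla_policy_backlog[abs_def] G_def A_def)
  qed
  moreover have "0 \<le> measure_pmf.expectation (history_pmf N P t) (\<lambda>h. potential (backlog N \<W> h))"
    using history_pmf_feasible[OF P] backlog_nonneg \<W>
    by (intro integral_nonneg_AE AE_pmfI potential_nonneg) blast
  moreover have "slot_expectation N P \<tau> G = \<eta> * L / 4 * expected_excess \<W> \<tau> -
      2 * \<eta> * K * (\<Sum>j\<in>UNIV. slot_expectation N P \<tau> (\<lambda>h s x. arr N s x $ j))" for \<tau>
  proof -
    have "slot_expectation N P \<tau> G = \<eta> * L / 4 * expected_excess \<W> \<tau> + - (2 * \<eta> * K) * slot_expectation N P \<tau> (\<lambda>h s x. A s x)"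
      unfolding G_def expected_excess_def P_def[symmetric]
      by (simp only: slot_expectation_cmult
          slot_expectation_add[OF P slot_bounded_cmult[OF slot_bounded_excess[OF \<W>]] slot_bounded_cmult[OF A]])
    then show ?thesis
      unfolding A_def
      using slot_expectation_sum[OF P, where I = UNIV and t = \<tau> and F = "\<lambda>j h s x. arr N s x $ j", OF slot_bounded_arr]
      by simp
  qed
  ultimately show ?thesis
    by (simp add: expected_generated_def sum_subtractf sum_distrib_left flip: P_def)
qed

lemma expected_generated_le:
  assumes \<W>: "\<And>j. 0 \<le> \<W> $ j"
  shows "expected_generated N R \<W> t \<le> CARD('r) * \<delta> * t"
proof -
  have "slot_expectation N (fqla_policy N R \<W>) \<tau> (\<lambda>h s x. arr N s x $ j) \<le> \<delta>" for \<tau> j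
    using slot_expectation_mono[OF fqla_policy_feasible[OF \<W>] slot_bounded_arr slot_bounded_const arr_le]
    by simp
  then have "expected_generated N R \<W> t \<le> (\<Sum>\<tau><t. \<Sum>j\<in>(UNIV::'r set). \<delta>)"
    unfolding expected_generated_def by (intro sum_mono)
  then show ?thesis by (simp add: algebra_simps)
qed

text \<open>
  At most \<open>CARD('r) * \<delta>\<close> packets arrive in a slot, so the accumulated excess grows at most linearly.
  This serves both for the backlog of FQLA and for the stability of its policy.
\<close>

lemma average_le_excess:
  assumes \<W>: "\<And>j. 0 \<le> \<W> $ j" and F: "\<And>j. slot_bounded N (F j)"
    and le: "\<And>h s x j. feasible_history N h \<Longrightarrow> x \<in> feas N s \<Longrightarrow> F j h s x \<le> b + excess (backlog N \<W> h) / \<eta>"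
  shows "time_average (\<lambda>t. \<Sum>j\<in>(UNIV::'r set). slot_expectation N (fqla_policy N R \<W>) t (F j))
    \<le> ereal (CARD('r) * (b + 8 * K * (CARD('r) * \<delta>) / (\<eta> * L)))"
proof (rule time_average_le)
  fix t
  let ?P = "fqla_policy N R \<W>" and ?r = "real CARD('r)"
  note P = fqla_policy_feasible[OF \<W>]
  have "slot_expectation N ?P \<tau> (F j) \<le> b + (1 / \<eta>) * expected_excess \<W> \<tau>" for \<tau> j
  proof -
    have "slot_expectation N ?P \<tau> (F j) \<le> slot_expectation N ?P \<tau> (\<lambda>h s x. b + (1 / \<eta>) * excess (backlog N \<W> h))"
      using le by (intro slot_expectation_mono[OF P F] slot_bounded_intros slot_bounded_excess[OF \<W>]) simp
    also have "\<dots> = b + (1 / \<eta>) * expected_excess \<W> \<tau>"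
      unfolding expected_excess_def
      by (simp only: slot_expectation_cmult slot_expectation_const
          slot_expectation_add[OF P slot_bounded_const slot_bounded_cmult[OF slot_bounded_excess[OF \<W>]]])
    finally show ?thesis .
  qed
  then have "(\<Sum>\<tau><t. \<Sum>j\<in>(UNIV::'r set). slot_expectation N ?P \<tau> (F j))
      \<le> (\<Sum>\<tau><t. \<Sum>j\<in>(UNIV::'r set). b + (1 / \<eta>) * expected_excess \<W> \<tau>)"
    by (intro sum_mono)
  also have "\<dots> = ?r * b * t + (4 * ?r / (\<eta>\<^sup>2 * L)) * (\<eta> * L / 4 * (\<Sum>\<tau><t. expected_excess \<W> \<tau>))"
    using \<eta>_pos L_pos
    by (simp add: sum.distrib power2_eq_square field_simps flip: sum_distrib_left sum_divide_distrib)
  also have "\<dots> \<le> ?r * b * t + (4 * ?r / (\<eta>\<^sup>2 * L)) * (potential \<W> + 2 * \<eta> * K * (?r * \<delta> * t))"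
  proof -
    have "2 * \<eta> * K * expected_generated N R \<W> t \<le> 2 * \<eta> * K * (?r * \<delta> * t)"
      using expected_generated_le[OF \<W>] \<eta>_pos K_pos by (intro mult_left_mono) auto
    then show ?thesis
      using excess_occupation[OF \<W>, of t] L_pos by (intro add_left_mono mult_left_mono) auto
  qed
  also have "\<dots> = (4 * ?r / (\<eta>\<^sup>2 * L)) * potential \<W> + ?r * (b + 8 * K * (?r * \<delta>) / (\<eta> * L)) * t"
    using \<eta>_pos L_pos by (simp add: power2_eq_square field_simps)
  finally show "(\<Sum>\<tau><t. \<Sum>j\<in>(UNIV::'r set). slot_expectation N ?P \<tau> (F j))
      \<le> (4 * ?r / (\<eta>\<^sup>2 * L)) * potential \<W> + ?r * (b + 8 * K * (?r * \<delta>) / (\<eta> * L)) * t" .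
qed

text \<open>
  The queues that start empty stay below the queues \<open>W\<close> that start at the level \<open>\<W>\<close> and are driven by
  the same actions.
\<close>

lemma fqla_policy_stable:
  assumes \<W>: "\<And>j. 0 \<le> \<W> $ j"
  shows "stable_policy N (fqla_policy N R \<W>)"
proof -
  have "average_backlog N (fqla_policy N R \<W>) \<le> ereal (CARD('r) * ((norm Us + rad) + 8 * K * (CARD('r) * \<delta>) / (\<eta> * L)))"
    unfolding average_backlog_def
  proof (rule average_le_excess[OF \<W> slot_bounded_backlog])
    fix h s x j assume h: "feasible_history N h"
    have "backlog N 0 h $ j \<le> backlog N \<W> h $ j"
      using backlog_mono[OF h, of 0 \<W>] \<W> by simp
    also have "\<dots> \<le> norm (backlog N \<W> h)"
      using component_le_norm_cart[of "backlog N \<W> h" j] by simp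
    also have "\<dots> \<le> norm Us + norm (backlog N \<W> h - Us)"
      using norm_triangle_ineq[of Us "backlog N \<W> h - Us"] by simp
    finally show "backlog N 0 h $ j \<le> norm Us + rad + excess (backlog N \<W> h) / \<eta>"
      using norm_le_excess[of "backlog N \<W> h"] by linarith
  qed simp
  then have "average_backlog N (fqla_policy N R \<W>) < \<infinity>"
    by (rule le_less_trans) simp
  then show ?thesis
    using fqla_policy_feasible[OF \<W>] by (auto simp: stable_policy_def feasible_policy_def feasible_history_def)
qed

text \<open>
  Drift inequality for \<open>(norm W)\<^sup>2 / 2\<close>: in each slot \<open>V\<close> times the expected cost plus the drift is at
  most the dual value at \<open>W\<close>, hence at most its maximum, plus a constant.
\<close>

lemma fqla_cost_upper:
  assumes \<W>: "\<And>j. 0 \<le> \<W> $ j"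
  shows "average_cost N (fqla_policy N R \<W>) \<le> ereal ((dual N V Us + 3 * CARD('r) * \<delta>\<^sup>2 / 2) / V)"
  unfolding average_cost_def
proof (rule time_average_le)
  fix t
  define P where "P = fqla_policy N R \<W>"
  define c where "c = dual N V Us + 3 * CARD('r) * \<delta>\<^sup>2 / 2"
  have P: "feasible_policy N P"
    unfolding P_def by (rule fqla_policy_feasible[OF \<W>])
  define \<Phi> where "\<Phi> h = (1 / 2) * (norm (backlog N \<W> h - 0) * norm (backlog N \<W> h - 0))" for h
  have \<Phi>: "slot_bounded N (\<lambda>h s x. \<Phi> h)"
    unfolding \<Phi>_def by (intro slot_bounded_cmult slot_bounded_mult slot_bounded_norm_backlog \<W>)
  have G: "slot_bounded N (\<lambda>h s x. V * cost N s x)"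
    by (intro slot_bounded_cmult slot_bounded_cost)
  have "measure_pmf.expectation (history_pmf N P t) \<Phi> + (\<Sum>\<tau><t. slot_expectation N P \<tau> (\<lambda>h s x. V * cost N s x))
      \<le> \<Phi> [] + c * real t"
  proof (rule telescoped_drift[OF P \<Phi> G])
    fix h assume h: "feasible_history N h"
    let ?W = "backlog N \<W> h"
    have W: "\<And>j. 0 \<le> ?W $ j" using backlog_nonneg[OF h \<W>] .
    have "slot_bounded N (\<lambda>h s x. \<Phi> (h @ [(s, x)]) + V * cost N s x)"
      by (intro slot_bounded_add slot_bounded_next[OF \<Phi> feas_nonempty] G)
    then obtain B where B: "\<And>h' s x. feasible_history N h' \<Longrightarrow> length h' = length h \<Longrightarrow> x \<in> feas N s \<Longrightarrow>
        \<bar>\<Phi> (h' @ [(s, x)]) + V * cost N s x\<bar> \<le> B"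
      using slot_boundedE by blast
    have "measure_pmf.expectation (action_pmf N (R ?W)) (\<lambda>(s, x). \<Phi> (h @ [(s, x)]) + V * cost N s x)
        \<le> (\<Phi> h + 3 * CARD('r) * \<delta>\<^sup>2 / 2) + 1 * measure_pmf.expectation (action_pmf N (R ?W)) (\<lambda>(s, x). lagrangian N V ?W s x)"
    proof (rule action_expectation_affine_le[OF R_feasible[OF W] B[OF h refl] abs_lagrangian_le])
      fix s x assume x: "x \<in> feas N s"
      have "lagrangian N V 0 s x = V * cost N s x"
        by (simp add: lagrangian_def)
      then show "\<Phi> (h @ [(s, x)]) + V * cost N s x \<le> \<Phi> h + 3 * CARD('r) * \<delta>\<^sup>2 / 2 + 1 * lagrangian N V ?W s x"
        using distance_square_after[OF W, of 0 x s] x by (simp add: \<Phi>_def power2_eq_square)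
    qed
    also have "\<dots> \<le> \<Phi> h + c"
    proof -
      have "dual N V ?W \<le> dual N V Us"
        using dual_sharp[OF W] L_pos by (smt (verit) mult_nonneg_nonneg norm_ge_zero)
      then show ?thesis
        using qla_expectation_le_dual[OF qla W] by (simp add: c_def)
    qed
    finally show "measure_pmf.expectation (action_pmf N (P h)) (\<lambda>(s, x). \<Phi> (h @ [(s, x)]) + V * cost N s x) \<le> \<Phi> h + c"
      by (simp add: P_def fqla_policy_backlog[abs_def])
  qed
  moreover have "0 \<le> measure_pmf.expectation (history_pmf N P t) \<Phi>"
    by (intro integral_nonneg_AE AE_pmfI) (simp add: \<Phi>_def)
  ultimately have "V * (\<Sum>\<tau><t. slot_expectation N P \<tau> (\<lambda>h s x. cost N s x)) \<le> \<Phi> [] + c * real t"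
    by (simp add: slot_expectation_cmult sum_distrib_left)
  then show "(\<Sum>\<tau><t. slot_expectation N (fqla_policy N R \<W>) \<tau> (\<lambda>h s x. cost N s x))
      \<le> \<Phi> [] / V + (dual N V Us + 3 * CARD('r) * \<delta>\<^sup>2 / 2) / V * real t"
    unfolding P_def[symmetric] c_def[symmetric] using V_ge_1 by (simp add: field_simps)
qed

lemma fqla_average_backlog_le:
  assumes \<W>: "\<And>j. 0 \<le> \<W> $ j" and level: "\<And>j. Us $ j - b \<le> \<W> $ j" and b: "0 \<le> b"
  shows "fqla_average_backlog N R \<W> \<le> ereal (CARD('r) * ((b + \<delta> + rad) + 8 * K * (CARD('r) * \<delta>) / (\<eta> * L)))"
  unfolding fqla_average_backlog_def
proof (rule average_le_excess[OF \<W> slot_bounded_fqla_backlog[OF \<W>]])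
  fix h s x j assume h: "feasible_history N h"
  have "backlog N \<W> h $ j - \<W> $ j \<le> norm (backlog N \<W> h - Us) + b"
    using component_le_norm_cart[of "backlog N \<W> h - Us" j] level[of j] by simp
  then have "fst (fqla_state N \<W> h) $ j \<le> norm (backlog N \<W> h - Us) + b + \<delta>"
    using fqla_backlog_bounds[OF h \<W>, of j] b norm_ge_zero[of "backlog N \<W> h - Us"] by linarith
  then show "fst (fqla_state N \<W> h) $ j \<le> b + \<delta> + rad + excess (backlog N \<W> h) / \<eta>"
    using norm_le_excess[of "backlog N \<W> h"] by linarith
qed

text \<open>
  A drop in queue \<open>j\<close> needs \<open>W $ j < \<W> $ j\<close>, hence a positive level.  Then \<open>W\<close> is at distance at least
  \<open>m\<close> from \<open>Us\<close>, where the excess is at least \<open>exp (\<eta> * m)\<close>.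
\<close>

lemma expected_dropped_le:
  assumes \<W>: "\<And>j. 0 \<le> \<W> $ j" and level: "\<And>j. 0 < \<W> $ j \<Longrightarrow> \<W> $ j \<le> Us $ j - m" and m: "rad \<le> m"
  shows "expected_dropped N R \<W> t \<le> CARD('r) * (\<delta> * exp (- \<eta> * m)) * (\<Sum>\<tau><t. expected_excess \<W> \<tau>)"
proof -
  let ?P = "fqla_policy N R \<W>" and ?d = "\<delta> * exp (- \<eta> * m)"
  note P = fqla_policy_feasible[OF \<W>]
  have "slot_expectation N ?P \<tau> (\<lambda>h s x. arr N s x $ j - admitted N \<W> (snd (fqla_state N \<W> h)) s x $ j)
      \<le> ?d * expected_excess \<W> \<tau>" for \<tau> j
    unfolding expected_excess_def slot_expectation_cmult[symmetric]
  proof (rule slot_expectation_mono[OF P slot_bounded_dropped slot_bounded_cmult[OF slot_bounded_excess[OF \<W>]]])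
    fix h s x assume h: "feasible_history N h" and x: "x \<in> feas N s"
    let ?W = "backlog N \<W> h"
    show "arr N s x $ j - admitted N \<W> (snd (fqla_state N \<W> h)) s x $ j \<le> ?d * excess ?W"
    proof (cases "\<W> $ j \<le> ?W $ j")
      case True
      then show ?thesis using \<delta>_pos excess_nonneg[of ?W] by (simp add: admitted_def)
    next
      case False
      have "0 \<le> ?W $ j" by (rule backlog_nonneg[OF h \<W>])
      then have "\<W> $ j \<le> Us $ j - m" using False level by simp
      then have "m \<le> \<bar>?W $ j - Us $ j\<bar>" using False by simp
      also have "\<dots> \<le> norm (?W - Us)"
        using component_le_norm_cart[of "?W - Us" j] by simp
      finally have m_le: "m \<le> norm (?W - Us)" .
      have "\<delta> * 1 \<le> \<delta> * exp (\<eta> * (norm (?W - Us) - m))"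
        using m_le \<eta>_pos \<delta>_pos by (intro mult_left_mono) auto
      also have "\<dots> = ?d * excess ?W"
        using m m_le by (simp add: excess_def algebra_simps flip: exp_add)
      finally show ?thesis
        using arr_le[OF x, of j] admitted_bounds(1)[OF x, of \<W> "snd (fqla_state N \<W> h)" j] by simp
    qed
  qed
  then have "expected_dropped N R \<W> t \<le> (\<Sum>\<tau><t. \<Sum>j\<in>(UNIV::'r set). ?d * expected_excess \<W> \<tau>)"
    unfolding expected_dropped_def by (intro sum_mono)
  then show ?thesis by (simp add: sum_distrib_left algebra_simps)
qed

text \<open>
  Both sides of the fraction are compared through the accumulated excess; the initial potential is divided by the
  unboundedly growing number of generated packets and vanishes.
\<close>

lemma drop_fraction_le:
  assumes \<W>: "\<And>j. 0 \<le> \<W> $ j" and level: "\<And>j. 0 < \<W> $ j \<Longrightarrow> \<W> $ j \<le> Us $ j - m" and m: "rad \<le> m"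
    and gen: "keeps_generating N R \<W>"
  shows "drop_fraction N R \<W> \<le> ereal (8 * K * (CARD('r) * \<delta>) / L * exp (- \<eta> * m))"
proof -
  let ?r = "real CARD('r)" and ?g = "expected_generated N R \<W>"
  define b where "b = ?r * (\<delta> * exp (- \<eta> * m)) * (4 / (\<eta> * L))"
  have b: "0 \<le> b" using \<delta>_pos \<eta>_pos L_pos by (simp add: b_def)
  have le: "expected_dropped N R \<W> t \<le> b * potential \<W> + b * (2 * \<eta> * K) * ?g t" for t
  proof -
    have "expected_dropped N R \<W> t \<le> b * (\<eta> * L / 4 * (\<Sum>\<tau><t. expected_excess \<W> \<tau>))"
      using expected_dropped_le[OF \<W> level m, of t] \<eta>_pos L_pos by (simp add: b_def)
    also have "\<dots> \<le> b * (potential \<W> + 2 * \<eta> * K * ?g t)"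
      by (intro mult_left_mono excess_occupation[OF \<W>] b)
    finally show ?thesis by (simp add: algebra_simps)
  qed
  have g: "filterlim ?g at_top sequentially"
    using gen by (simp add: keeps_generating_def)
  have "(\<lambda>t. ereal (b * potential \<W> / ?g t + b * (2 * \<eta> * K))) \<longlonglongrightarrow> ereal (0 + b * (2 * \<eta> * K))"
    by (intro tendsto_intros real_tendsto_divide_at_top[OF tendsto_const g])
  then have lim: "limsup (\<lambda>t. ereal (b * potential \<W> / ?g t + b * (2 * \<eta> * K))) = ereal (b * (2 * \<eta> * K))"
    by (simp add: lim_imp_Limsup)
  have "\<forall>\<^sub>F t in sequentially. 0 < ?g t"
    using g by (simp add: filterlim_at_top_dense)
  then have "\<forall>\<^sub>F t in sequentially. ereal (expected_dropped N R \<W> t / ?g t)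
      \<le> ereal (b * potential \<W> / ?g t + b * (2 * \<eta> * K))"
  proof eventually_elim
    case (elim t)
    then show ?case using le[of t] by (simp add: field_simps)
  qed
  then have "drop_fraction N R \<W> \<le> ereal (b * (2 * \<eta> * K))"
    unfolding drop_fraction_def lim[symmetric] by (rule Limsup_mono)
  also have "b * (2 * \<eta> * K) = 8 * K * (?r * \<delta>) / L * exp (- \<eta> * m)"
    using \<eta>_pos by (simp add: b_def)
  finally show ?thesis .
qed

end

section \<open>Performance from a good placeholder level\<close>

text \<open>
  A sample with \<open>exp (\<eta> * norm (w - Us)) < V ^ 4\<close> is within \<open>4 * ln V / \<eta>\<close> of \<open>Us\<close>, and this is at most
  half of \<open>(ln V)\<^sup>2\<close> for large \<open>V\<close>.  So every positive level lies between \<open>(ln V)\<^sup>2 / 2\<close> and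
  \<open>3 / 2 * (ln V)\<^sup>2\<close> below \<open>Us\<close>: low enough for drops to be rare, and high enough for the real
  backlog to be small.
\<close>

lemma (in qla_chain) fqla_performance:
  assumes w: "\<And>j. 0 \<le> w $ j" and close: "exp (\<eta> * norm (w - Us)) < V ^ 4"
    and large: "1 \<le> ln V" "8 / \<eta> \<le> ln V" "2 * rad \<le> ln V"
  defines "\<W> \<equiv> fqla_level V w"
  shows "fqla_average_backlog N R \<W> \<le>
      ereal (CARD('r) * (3 / 2 + \<delta> + rad + 8 * K * (CARD('r) * \<delta>) / (\<eta> * L)) * (ln V)\<^sup>2)"
    and "\<bar>fqla_average_cost N R \<W> - optimal_cost N\<bar> \<le> ereal ((3 * CARD('r) * \<delta>\<^sup>2 / 2) / V)"
    and "keeps_generating N R \<W> \<Longrightarrow> drop_fraction N R \<W> \<le>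
      ereal (8 * K * (CARD('r) * \<delta>) / L / V powr (\<eta> / 2 * ln V))"
proof -
  define a where "a = (ln V)\<^sup>2"
  have V: "0 < V" using V_ge_1 by simp
  have a_ln: "ln V \<le> a" "1 \<le> a"
    using large(1) self_le_power[of "ln V" 2] by (auto simp: a_def)
  have "exp (\<eta> * norm (w - Us)) < exp (4 * ln V)"
    using close V exp_of_nat_mult[of 4 "ln V"] by simp
  then have "norm (w - Us) < 4 * ln V / \<eta>"
    using \<eta>_pos by (simp add: field_simps)
  moreover have "4 * ln V / \<eta> \<le> a / 2"
    using mult_right_mono[OF large(2), of "ln V"] large(1) by (simp add: a_def power2_eq_square)
  ultimately have dist: "norm (w - Us) \<le> a / 2" by linarith
  have coord: "\<bar>w $ j - Us $ j\<bar> \<le> a / 2" for j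
    using component_le_norm_cart[of "w - Us" j] dist by simp
  have \<W>: "\<W> $ j = max (w $ j - a) 0" for j
    by (simp add: \<W>_def fqla_level_def a_def)
  have \<W>_nonneg: "0 \<le> \<W> $ j" for j by (simp add: \<W>)
  have lower: "Us $ j - 3 / 2 * a \<le> \<W> $ j" for j
    using coord[of j] unfolding \<W> by linarith
  have upper: "\<W> $ j \<le> Us $ j - a / 2" if "0 < \<W> $ j" for j
    using coord[of j] that unfolding \<W> by linarith

  define c where "c = 8 * K * (CARD('r) * \<delta>) / (\<eta> * L)"
  have c: "0 \<le> c" using K_pos \<delta>_pos \<eta>_pos L_pos by (simp add: c_def)
  have "fqla_average_backlog N R \<W> \<le> ereal (CARD('r) * (3 / 2 * a + \<delta> + rad + c))"
    unfolding c_def using a_ln by (intro fqla_average_backlog_le \<W>_nonneg lower) simp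
  also have "\<dots> \<le> ereal (CARD('r) * (3 / 2 + \<delta> + rad + c) * a)"
  proof -
    have "\<delta> + rad + c \<le> (\<delta> + rad + c) * a"
      using mult_left_mono[OF a_ln(2), of "\<delta> + rad + c"] \<delta>_pos rad_pos c by simp
    then have "CARD('r) * (3 / 2 * a + \<delta> + rad + c) \<le> CARD('r) * ((3 / 2 + \<delta> + rad + c) * a)"
      by (intro mult_left_mono) (auto simp: algebra_simps)
    then show ?thesis by (simp add: mult.assoc)
  qed
  finally show "fqla_average_backlog N R \<W> \<le>
      ereal (CARD('r) * (3 / 2 + \<delta> + rad + 8 * K * (CARD('r) * \<delta>) / (\<eta> * L)) * (ln V)\<^sup>2)"
    by (simp add: a_def c_def)

  show "drop_fraction N R \<W> \<le> ereal (8 * K * (CARD('r) * \<delta>) / L / V powr (\<eta> / 2 * ln V))"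
    if "keeps_generating N R \<W>"
  proof -
    have "drop_fraction N R \<W> \<le> ereal (8 * K * (CARD('r) * \<delta>) / L * exp (- \<eta> * (a / 2)))"
      using a_ln large(3) by (intro drop_fraction_le[OF \<W>_nonneg upper _ that]) auto
    also have "exp (- \<eta> * (a / 2)) = 1 / V powr (\<eta> / 2 * ln V)"
      using V by (simp add: powr_def a_def power2_eq_square exp_minus inverse_eq_divide algebra_simps)
    finally show ?thesis by simp
  qed

  define u where "u = (1 / V) *\<^sub>R Us"
  have u: "0 \<le> u $ j" for j using Us_nonneg V by (simp add: u_def)
  have dual_u: "dual N V Us / V = dual N 1 u"
    using dual_scale[OF V, of u] V by (simp add: u_def)
  have lower_opt: "ereal (dual N 1 u) \<le> optimal_cost N"
    unfolding optimal_cost_def using dual_le_average_cost[OF _ u] by (auto intro: INF_greatest)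
  \<comment> \<open>FQLA makes the decisions of a stable policy, so its cost is never below the optimum.\<close>
  have opt_le: "optimal_cost N \<le> fqla_average_cost N R \<W>"
    unfolding optimal_cost_def fqla_average_cost_def
    using fqla_policy_stable[OF \<W>_nonneg] by (intro INF_lower) simp
  have "fqla_average_cost N R \<W> \<le> ereal (dual N 1 u + (3 * CARD('r) * \<delta>\<^sup>2 / 2) / V)"
    using fqla_cost_upper[OF \<W>_nonneg] unfolding fqla_average_cost_def
    by (simp add: add_divide_distrib dual_u)
  with lower_opt opt_le show "\<bar>fqla_average_cost N R \<W> - optimal_cost N\<bar> \<le> ereal ((3 * CARD('r) * \<delta>\<^sup>2 / 2) / V)"
    by (cases "fqla_average_cost N R \<W>"; cases "optimal_cost N") auto
qed

theorem theorem6: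
  fixes N :: "('s::finite, 'x::topological_space, 'r::finite) network"
    and \<delta>max \<epsilon> L :: real
    and U0star :: "real^'r"
    and R :: "real \<Rightarrow> real^'r \<Rightarrow> 's \<Rightarrow> 'x pmf"
    and D :: "real \<Rightarrow> (real^'r) pmf"
  assumes model: "network_model N \<delta>max"
    and unique: "\<forall>V\<ge>1. \<exists>!U. dual_maximizer N V U"
    and U0star: "dual_maximizer N 1 U0star"
    and "\<epsilon> > 0" and "L > 0"
    and polyhedral: "locally_polyhedral (dual N 1) U0star \<epsilon> L"
    and qla: "\<forall>V\<ge>1. qla_rule N V (R V)"
    and steady: "\<forall>V\<ge>1. steady_state N (R V) (D V)"
  shows "\<exists>c0>0. \<exists>C V0. \<forall>V\<ge>max V0 1.
    measure_pmf.prob (D V)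
      {w. fqla_average_backlog N (R V) (fqla_level V w) \<le> ereal (C * (ln V)\<^sup>2) \<and>
          \<bar>fqla_average_cost N (R V) (fqla_level V w) - optimal_cost N\<bar> \<le> ereal (C / V) \<and>
          (keeps_generating N (R V) (fqla_level V w) \<longrightarrow>
             drop_fraction N (R V) (fqla_level V w) \<le> ereal (C / V powr (c0 * ln V)))}
      \<ge> 1 - C / V ^ 4"
proof -
  interpret bounded_network N \<delta>max
    using model by (rule network_model_bounded)
  define \<nu> where "\<nu> = CARD('r) * \<delta>max"
  have \<nu>: "0 < \<nu>" using \<delta>_pos by (simp add: \<nu>_def)
  define \<eta> where "\<eta> = Min {1 / \<nu>, L / (4 * \<nu>\<^sup>2), 4 / L}"
  have \<eta>: "0 < \<eta>" "\<eta> \<le> 1 / \<nu>" "\<eta> \<le> L / (4 * \<nu>\<^sup>2)" "\<eta> \<le> 4 / L"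
    using \<nu> \<open>L > 0\<close> by (auto simp: \<eta>_def)
  define rad where "rad = 3 * CARD('r) * \<delta>max\<^sup>2 / L"
  define K where "K = exp (\<eta> * (rad + \<nu>))"
  have rad: "0 \<le> rad" using \<open>L > 0\<close> by (simp add: rad_def)
  have K: "0 < K" by (simp add: K_def)
  have U0: "0 \<le> U0star $ j" for j
    using U0star by (simp add: dual_maximizer_def)
  have chain: "qla_chain N \<delta>max V (R V) (V *\<^sub>R U0star) L \<eta> rad K" if V: "1 \<le> V" for V
  proof
    show "dual N V U + L * norm (U - V *\<^sub>R U0star) \<le> dual N V (V *\<^sub>R U0star)" if "\<And>j. 0 \<le> U $ j" for U
      using V that \<open>\<epsilon> > 0\<close> \<open>L > 0\<close> by (intro polyhedral_scaled[OF polyhedral _ _ U0]) auto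
    show "\<eta> * (CARD('r) * \<delta>max) \<le> 1" "4 * \<eta> * (CARD('r) * \<delta>max)\<^sup>2 \<le> L" "\<eta> * L \<le> 4"
      using \<eta> \<nu> \<open>L > 0\<close> unfolding \<nu>_def[symmetric] by (auto simp: field_simps)
    show "3 * CARD('r) * \<delta>max\<^sup>2 \<le> L * rad" using \<open>L > 0\<close> by (simp add: rad_def)
    show "exp (\<eta> * (rad + CARD('r) * \<delta>max)) \<le> K" by (simp add: K_def \<nu>_def)
  qed (use V qla U0 \<eta> \<open>L > 0\<close> in auto)

  define C1 where "C1 = CARD('r) * (3 / 2 + \<delta>max + rad + 8 * K * \<nu> / (\<eta> * L))"
  define C2 where "C2 = 3 * CARD('r) * \<delta>max\<^sup>2 / 2"
  define C3 where "C3 = 8 * K * \<nu> / L"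
  define C4 where "C4 = 4 * K / (\<eta> * L)"
  define C where "C = C1 + C2 + C3 + C4"
  have "0 \<le> C1" "0 \<le> C2" "0 \<le> C3" "0 \<le> C4"
    using \<delta>_pos rad K \<nu> \<eta>(1) \<open>L > 0\<close> by (auto simp: C1_def C2_def C3_def C4_def)
  then have C: "C1 \<le> C" "C2 \<le> C" "C3 \<le> C" "C4 \<le> C" by (auto simp: C_def)
  define V0 where "V0 = exp (1 + 8 / \<eta> + 2 * rad)"
  show ?thesis
  proof (rule exI[of _ "\<eta> / 2"], rule conjI, simp add: \<eta>(1),
      rule exI[of _ C], rule exI[of _ V0], intro allI impI)
    fix V assume "max V0 1 \<le> V"
    then have V: "1 \<le> V" "exp (1 + 8 / \<eta> + 2 * rad) \<le> V" by (auto simp: V0_def)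
    then have lnV: "1 + 8 / \<eta> + 2 * rad \<le> ln V"
      by (simp add: ln_ge_iff)
    interpret qla_chain N \<delta>max V "R V" "V *\<^sub>R U0star" L \<eta> rad K
      by (rule chain[OF V(1)])
    \<comment> \<open>The exponent 4 of the probability comes from this choice of the threshold for the exponential.\<close>
    let ?good = "{w. exp (\<eta> * norm (w - V *\<^sub>R U0star)) < V ^ 4}"
    let ?S = "{w. fqla_average_backlog N (R V) (fqla_level V w) \<le> ereal (C * (ln V)\<^sup>2) \<and>
          \<bar>fqla_average_cost N (R V) (fqla_level V w) - optimal_cost N\<bar> \<le> ereal (C / V) \<and>
          (keeps_generating N (R V) (fqla_level V w) \<longrightarrow>
             drop_fraction N (R V) (fqla_level V w) \<le> ereal (C / V powr (\<eta> / 2 * ln V)))}"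
    have D: "steady_state N (R V) (D V)" using steady V by simp
    have "w \<in> ?S" if w: "w \<in> set_pmf (D V)" and close: "w \<in> ?good" for w
    proof -
      have "0 \<le> w $ j" for j
        using D w by (simp add: steady_state_def)
      note perf = fqla_performance[OF this]
      have large: "1 \<le> ln V" "8 / \<eta> \<le> ln V" "2 * rad \<le> ln V"
        using lnV rad \<eta>(1) by (auto intro: order_trans[rotated])
      have "fqla_average_backlog N (R V) (fqla_level V w) \<le> ereal (C1 * (ln V)\<^sup>2)"
        using perf(1)[OF _ large] close by (simp add: C1_def \<nu>_def)
      also have "\<dots> \<le> ereal (C * (ln V)\<^sup>2)"
        using C by (simp add: mult_right_mono)
      finally have backlog: "fqla_average_backlog N (R V) (fqla_level V w) \<le> ereal (C * (ln V)\<^sup>2)" .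
      have "\<bar>fqla_average_cost N (R V) (fqla_level V w) - optimal_cost N\<bar> \<le> ereal (C2 / V)"
        using perf(2)[OF _ large] close by (simp add: C2_def)
      also have "\<dots> \<le> ereal (C / V)"
        using C V by (simp add: divide_right_mono)
      finally have cost: "\<bar>fqla_average_cost N (R V) (fqla_level V w) - optimal_cost N\<bar> \<le> ereal (C / V)" .
      have drop: "drop_fraction N (R V) (fqla_level V w) \<le> ereal (C / V powr (\<eta> / 2 * ln V))"
        if "keeps_generating N (R V) (fqla_level V w)"
      proof -
        have "drop_fraction N (R V) (fqla_level V w) \<le> ereal (C3 / V powr (\<eta> / 2 * ln V))"
          using perf(3)[OF _ large that] close by (simp add: C3_def \<nu>_def)
        also have "\<dots> \<le> ereal (C / V powr (\<eta> / 2 * ln V))"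
          using C V by (simp add: divide_right_mono)
        finally show ?thesis .
      qed
      show ?thesis using backlog cost drop by blast
    qed
    then have "measure_pmf.prob (D V) ?good \<le> measure_pmf.prob (D V) ?S"
      by (intro measure_pmf.finite_measure_mono_AE) (auto simp: AE_measure_pmf_iff)
    moreover have "measure_pmf.prob (D V) ?good =
        1 - measure_pmf.prob (D V) {w. V ^ 4 \<le> exp (\<eta> * norm (w - V *\<^sub>R U0star))}"
      using measure_pmf.prob_compl[of "{w. V ^ 4 \<le> exp (\<eta> * norm (w - V *\<^sub>R U0star))}" "D V"]
      by (simp add: set_diff_eq not_le)
    moreover have "measure_pmf.prob (D V) {w. V ^ 4 \<le> exp (\<eta> * norm (w - V *\<^sub>R U0star))} \<le> C4 / V ^ 4"
      using steady_state_tail[OF D, of "V ^ 4"] V by (simp add: C4_def)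
    moreover have "C4 / V ^ 4 \<le> C / V ^ 4"
      using C V by (simp add: divide_right_mono)
    ultimately show "1 - C / V ^ 4 \<le> measure_pmf.prob (D V) ?S" by linarith
  qed
qed

end
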